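(* Fix $c_0>0$. There is a constant $C>0$ depending only on $c_0$ such that the following holds. Let $q_{\mathrm{data}}=q_0$ be any distribution on $[S]^d$, $T>0$, $0=t_0<\dots<t_N=T$ a grid with step sizes $h_k:=t_{k+1}-t_k$ and $\max_k h_k\le c_0$, and let positive score estimates $\hat s_{T-t_k}$ satisfy the (masking) approximation-error assumption with parameter $\varepsilon_{\mathrm{score}}$. Let $$p_0=\Big((1-e^{-T})\delta_{\mathrm{MASK}}+S^{-1}e^{-T}\textstyle\sum_{a=1}^S\delta_a\Big)^{\otimes d}.$$ Then the law $p_{\mathrm{output}}$ of the output of the modified truncated $\tau$-leaping algorithm initialized at $p_0$ satisfies $$\mathsf{KL}(q_{\mathrm{data}}\,\|\,p_{\mathrm{output}})\le C\Big(\varepsilon_{\mathrm{score}}+e^{-T}d\log S+\sum_{k=0}^{N-1}h_k\int_{T-t_{k+1}}^{T-t_k}\mathcal I(t)\,dt\Big).$$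
   Context: $d\ge1$, $S\ge2$, $\mathcal V=[S]\cup\{\mathrm{MASK}\}$, $\mathcal X=\mathcal V^d$. For $x\in\mathcal X$: $m(x)=\{i\in[d]:x^i=\mathrm{MASK}\}$, and $x\odot_i c$ is $x$ with coordinate $i$ set to $c\in\mathcal V$. The masking noising process with initial law $q_0$ on $[S]^d$ is the time-homogeneous CTMC on $\mathcal X$ with rates $Q(x,y)=1$ if $y=x\odot_i\mathrm{MASK}$ for some $i\notin m(x)$ and $Q(x,y)=0$ for all other $y\ne x$ (each coordinate independently becomes MASK at an Exp(1) time and stays masked); $q_t$ is its law at time $t$; score $s_t(y,x)=q_t(y)/q_t(x)$. $D(a,b)=a/b-1-\log(a/b)$; $\mathcal L_{\mathrm{SE}}(t,\hat s,s)=\mathbb E_{x\sim q_t}[\sum_{y\neq x}Q(y,x)s(y,x)D(\hat s(y,x),s(y,x))]$. Approximation-error assumption: estimates $\hat s_{T-t_k}:\mathcal X\times\mathcal X\to(0,\infty)$ with $\sum_{k=0}^{N-1}(t_{k+1}-t_k)\mathcal L_{\mathrm{SE}}(T-t_k,\hat s_{T-t_k},s_{T-t_k})\le\varepsilon_{\mathrm{score}}$. Effective-total-correlation integrand: $\mathcal I(t)=\sum_{i\ne j\in[d]}\mathrm I\big(x_t^i;x_t^j\mid (x_t^k)_{k\notin\{i,j\}}\big)$ with $x_t\sim q_t$ (MASK treated as a symbol), $\mathrm I$ conditional mutual information. Modified truncated $\tau$-leaping algorithm: draw $x_{t_0}\sim p_0$. For $k=0,\dots,N-1$: unmasked coordinates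 of $x_{t_k}$ are kept; independently for each $i\in m(x_{t_k})$ set $\widehat Q^i_k(a)=\hat s_{T-t_k}(x_{t_k}\odot_i a,x_{t_k})$ for $a\in[S]$ and $\Lambda=\sum_{a\in[S]}\widehat Q^i_k(a)$; if $k<N-1$ let $\Delta_k=(e^{T-t_k}-1)\log\frac{e^T-e^{t_k}}{e^T-e^{t_{k+1}}}$ and $\mathcal P_k=\exp(-\Lambda\Delta_k)$, while for $k=N-1$ let $\mathcal P_k=0$; then $x^i_{t_{k+1}}=\mathrm{MASK}$ with probability $\mathcal P_k$ and $x^i_{t_{k+1}}=a$ with probability $(1-\mathcal P_k)\widehat Q^i_k(a)/\Lambda$, $a\in[S]$. The output is $x_{t_N}$. *)

theory Defs
  imports "HOL-Analysis.Analysis"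
begin

text \<open>States: lists of length d over the vocabulary [S] \<union> {MASK};
  MASK is None, the symbol a \<in> [S] = {1..S} is Some a.\<close>

type_synonym state = "nat option list"

definition vocab :: "nat \<Rightarrow> nat option set" where
  "vocab S = insert None (Some ` {1..S})"

definition states :: "nat \<Rightarrow> nat \<Rightarrow> state set" where
  "states d S = {x. length x = d \<and> set x \<subseteq> vocab S}"

definition data_states :: "nat \<Rightarrow> nat \<Rightarrow> state set" where
  "data_states d S = {x. length x = d \<and> set x \<subseteq> Some ` {1..S}}"

definition mask_rate :: "nat \<Rightarrow> state \<Rightarrow> state \<Rightarrow> real" where
  "mask_rate d x y = (if \<exists>i<d. x ! i \<noteq> None \<and> y = x[i := None] then 1 else 0)"

definition mask_law :: "nat \<Rightarrow> nat \<Rightarrow> (state \<Rightarrow> real) \<Rightarrow> real \<Rightarrow> state \<Rightarrow> real" where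
  "mask_law d S q0 t y =
     (\<Sum>x\<in>data_states d S. q0 x *
        (\<Prod>i<d. if y ! i = None then 1 - exp (- t)
                 else if y ! i = x ! i then exp (- t) else 0))"

definition score :: "nat \<Rightarrow> nat \<Rightarrow> (state \<Rightarrow> real) \<Rightarrow> real \<Rightarrow> state \<Rightarrow> state \<Rightarrow> real" where
  "score d S q0 t y x = mask_law d S q0 t y / mask_law d S q0 t x"

definition Dfun :: "real \<Rightarrow> real \<Rightarrow> real" where
  "Dfun a b = a / b - 1 - ln (a / b)"

text \<open>s * D(shat, s), with its continuous extension shat at s = 0.\<close>
definition weighted_D :: "real \<Rightarrow> real \<Rightarrow> real" where
  "weighted_D a s = (if s = 0 then a else s * Dfun a s)"

definition L_SE :: "nat \<Rightarrow> nat \<Rightarrow> (state \<Rightarrow> real) \<Rightarrow> real \<Rightarrow> (state \<Rightarrow> state \<Rightarrow> real) \<Rightarrow> real" where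
  "L_SE d S q0 t shat =
     (\<Sum>x\<in>{x\<in>states d S. mask_law d S q0 t x > 0}. mask_law d S q0 t x *
        (\<Sum>y\<in>states d S - {x}. mask_rate d y x * weighted_D (shat y x) (score d S q0 t y x)))"

definition cond_mi :: "nat \<Rightarrow> nat \<Rightarrow> (state \<Rightarrow> real) \<Rightarrow> nat \<Rightarrow> nat \<Rightarrow> real" where
  "cond_mi d S q i j =
     (\<Sum>x\<in>{x\<in>states d S. q x > 0}.
        let p_iz = (\<Sum>b\<in>vocab S. q (x[j := b]));
            p_jz = (\<Sum>a\<in>vocab S. q (x[i := a]));
            p_z  = (\<Sum>a\<in>vocab S. \<Sum>b\<in>vocab S. q (x[i := a, j := b]))
        in q x * ln (q x * p_z / (p_iz * p_jz)))"

definition eff_tc :: "nat \<Rightarrow> nat \<Rightarrow> (state \<Rightarrow> real) \<Rightarrow> real \<Rightarrow> real" where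
  "eff_tc d S q0 t = (\<Sum>i<d. \<Sum>j\<in>{..<d} - {i}. cond_mi d S (mask_law d S q0 t) i j)"

definition init_law :: "nat \<Rightarrow> nat \<Rightarrow> real \<Rightarrow> state \<Rightarrow> real" where
  "init_law d S T x = (\<Prod>i<d. if x ! i = None then 1 - exp (- T)
                             else if x ! i \<in> Some ` {1..S} then exp (- T) / real S else 0)"

definition Delta :: "real \<Rightarrow> (nat \<Rightarrow> real) \<Rightarrow> nat \<Rightarrow> real" where
  "Delta T t k = (exp (T - t k) - 1) * ln ((exp T - exp (t k)) / (exp T - exp (t (Suc k))))"

definition Lam :: "nat \<Rightarrow> (nat \<Rightarrow> state \<Rightarrow> state \<Rightarrow> real) \<Rightarrow> nat \<Rightarrow> state \<Rightarrow> nat \<Rightarrow> real" where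
  "Lam S shat k x i = (\<Sum>a\<in>{1..S}. shat k (x[i := Some a]) x)"

definition stay_prob :: "nat \<Rightarrow> real \<Rightarrow> (nat \<Rightarrow> real) \<Rightarrow> nat \<Rightarrow>
     (nat \<Rightarrow> state \<Rightarrow> state \<Rightarrow> real) \<Rightarrow> nat \<Rightarrow> state \<Rightarrow> nat \<Rightarrow> real" where
  "stay_prob S T t N shat k x i =
     (if k < N - 1 then exp (- Lam S shat k x i * Delta T t k) else 0)"

text \<open>One-coordinate transition probability of step k from x (coordinate i to value c).
  shat k stands for the estimate at time T - t_k.\<close>
definition coord_trans :: "nat \<Rightarrow> real \<Rightarrow> (nat \<Rightarrow> real) \<Rightarrow> nat \<Rightarrow>
     (nat \<Rightarrow> state \<Rightarrow> state \<Rightarrow> real) \<Rightarrow> nat \<Rightarrow> state \<Rightarrow> nat \<Rightarrow> nat option \<Rightarrow> real" where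
  "coord_trans S T t N shat k x i c =
     (if x ! i \<noteq> None then (if c = x ! i then 1 else 0)
      else (case c of
              None \<Rightarrow> stay_prob S T t N shat k x i
            | Some a \<Rightarrow> if a \<in> {1..S}
                        then (1 - stay_prob S T t N shat k x i) * shat k (x[i := Some a]) x
                               / Lam S shat k x i
                        else 0))"

primrec alg_law :: "nat \<Rightarrow> nat \<Rightarrow> real \<Rightarrow> (nat \<Rightarrow> real) \<Rightarrow> nat \<Rightarrow>
     (nat \<Rightarrow> state \<Rightarrow> state \<Rightarrow> real) \<Rightarrow> nat \<Rightarrow> state \<Rightarrow> real" where
  "alg_law d S T t N shat 0 = init_law d S T"
| "alg_law d S T t N shat (Suc k) =
     (\<lambda>y. \<Sum>x\<in>states d S. alg_law d S T t N shat k x *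
                (\<Prod>i<d. coord_trans S T t N shat k x i (y ! i)))"

definition KL :: "state set \<Rightarrow> (state \<Rightarrow> real) \<Rightarrow> (state \<Rightarrow> real) \<Rightarrow> ereal" where
  "KL X q p = (if \<exists>x\<in>X. q x > 0 \<and> p x = 0 then \<infinity>
               else ereal (\<Sum>x\<in>{x\<in>X. q x > 0}. q x * ln (q x / p x)))"

end

theory Submission
  imports Defs
begin

text \<open>
  The relative entropy is bounded along the grid by the chain rule: one step adds at most the
  expected relative entropy between the true reverse kernel and the kernel of the algorithm. With
  \<open>m x\<close> the \<open>q0\<close>-probability of the unmasked part of \<open>x\<close>, the density of \<open>q\<^sub>t\<close> factors into an explicit
  weight and \<open>m\<close>, so this error splits into two parts. The first is a sum over coordinates of
  relative entropies between one-coordinate kernels; the scalar inequality \<open>bernoulli_KL_le\<close> bounds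
  it by \<open>e\<^sup>h - 1\<close> times the score entropy, uniformly in the step, although \<open>Delta\<close> itself is not
  comparable to the step size when the remaining time is small. The second is the linearization
  error of \<open>G t = E (ln m x\<^sub>t)\<close> around the noisier end \<open>u + h\<close> of the step. Applying the
  generator of the masking process twice gives \<open>G'' + G' = eff_tc\<close>, so this error equals the integral of
  \<open>(e\<^sup>v\<^sup>-\<^sup>u - 1) eff_tc v\<close> over \<open>v \<in> [u, u + h]\<close>. Convexity of \<open>exp\<close> turns \<open>e\<^sup>h - 1\<close> into
  \<open>C h\<close> with \<open>C = (e\<^sup>c\<^sup>0 - 1) / c0\<close>, and \<open>C \<ge> 1\<close> absorbs the initialization error.
\<close>

section \<open>Scalar and relative entropy inequalities\<close>

text \<open>This is u <= 2 sinh (u/2). Its square decides the sign of the derivative in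
  \<open>inverse_diff_exp_antimono\<close>.\<close>

lemma mult_exp_half_le: "u * exp (u / 2) \<le> exp u - (1::real)" if "u \<ge> 0"
proof -
  have "(\<lambda>u. exp u - 1 - u * exp (u / 2)) 0 \<le> (\<lambda>u. exp u - 1 - u * exp (u / 2)) (u::real)"
  proof (rule DERIV_nonneg_imp_nondecreasing[OF that])
    fix x :: real
    have "((\<lambda>u. exp u - 1 - u * exp (u / 2)) has_real_derivative
            exp (x / 2) * (exp (x / 2) - 1 - x / 2)) (at x)"
      by (auto intro!: derivative_eq_intros simp: algebra_simps simp flip: exp_add)
    moreover have "exp (x / 2) * (exp (x / 2) - 1 - x / 2) \<ge> 0"
      using exp_ge_add_one_self[of "x / 2"] by (intro mult_nonneg_nonneg) (simp, linarith)
    ultimately show "\<exists>y. ((\<lambda>u. exp u - 1 - u * exp (u / 2)) has_real_derivative y) (at x) \<and> 0 \<le> y"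
      by blast
  qed
  then show ?thesis by simp
qed

text \<open>The derivative exp x / (exp x - 1)^2 - 1 / x^2 is nonpositive by the square of
  \<open>mult_exp_half_le\<close>. This function governs the dependence on the rate ratio in
  \<open>bernoulli_KL_le\<close>.\<close>

lemma inverse_diff_exp_antimono:
  fixes u v :: real
  assumes "0 < u" "u \<le> v"
  shows "1 / v - 1 / (exp v - 1) \<le> 1 / u - 1 / (exp u - 1)"
proof (rule DERIV_nonpos_imp_nonincreasing[OF assms(2)])
  fix x :: real assume "u \<le> x" "x \<le> v"
  then have x: "x > 0" using assms by simp
  then have e: "exp x - 1 > 0" by simp
  have "((\<lambda>x. 1 / x - 1 / (exp x - 1)) has_real_derivative
          exp x / (exp x - 1)^2 - 1 / x^2) (at x)"
    using x e by (auto intro!: derivative_eq_intros simp: power2_eq_square)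
  moreover have "exp x * x^2 = (x * exp (x / 2))^2"
    by (simp add: power_mult_distrib exp_double[symmetric] mult.commute)
  then have "exp x * x^2 \<le> (exp x - 1)^2"
    using mult_exp_half_le[of x] x by (metis less_eq_real_def mult_nonneg_nonneg exp_ge_zero power_mono)
  then have "exp x / (exp x - 1)^2 - 1 / x^2 \<le> 0"
    using x e by (simp add: field_simps)
  ultimately show "\<exists>y. ((\<lambda>x. 1 / x - 1 / (exp x - 1)) has_real_derivative y) (at x) \<and> y \<le> 0"
    by blast
qed

text \<open>The left side is the relative entropy of a two-point law with exit probability 1 - exp
  (-\<delta>) from one with exit probability 1 - exp (-r \<delta>); r will be the ratio of the
  estimated to the true total rate. Both sides vanish at r = 1, and right minus left decreases
  before 1 and increases after it. The factor \<rho> rather than \<delta> on the right matters,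
  because \<delta> is unbounded as \<rho> tends to 1.\<close>

lemma bernoulli_KL_le:
  fixes \<delta> r :: real
  assumes \<delta>: "\<delta> > 0" and r: "r > 0"
  defines "\<rho> \<equiv> 1 - exp (- \<delta>)"
  shows "exp (- \<delta>) * \<delta> * (r - 1) + \<rho> * ln (\<rho> / (1 - exp (- (r * \<delta>)))) \<le> \<rho> * (r - 1 - ln r)"
proof -
  \<comment> \<open>Up to the constant \<open>\<rho> * ln \<rho>\<close>, \<open>F r\<close> is the
    right side minus the left side, so the claim becomes \<open>F 1 \<le> F r\<close>.\<close>
  define F where "F r = \<rho> * (r - 1 - ln r) - exp (- \<delta>) * \<delta> * (r - 1) + \<rho> * ln (1 - exp (- (r * \<delta>)))" for r
  define g where "g u = 1 / u - 1 / (exp u - 1)" for u :: real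
  have \<rho>: "\<rho> > 0" using \<delta> by (simp add: \<rho>_def)
  have deriv: "(F has_real_derivative \<rho> * \<delta> * (g \<delta> - g (x * \<delta>))) (at x)" if x: "x > 0" for x
  proof -
    have xd: "x * \<delta> > 0" using x \<delta> by simp
    then have e: "exp (- (x * \<delta>)) < 1" by simp
    have D: "(F has_real_derivative \<rho> * (1 - 1 / x) - exp (- \<delta>) * \<delta> +
             \<rho> * (\<delta> * exp (- (x * \<delta>)) / (1 - exp (- (x * \<delta>))))) (at x)"
      unfolding F_def using x e by (auto intro!: derivative_eq_intros simp: field_simps)
    have "\<delta> * exp (- (x * \<delta>)) / (1 - exp (- (x * \<delta>))) = \<delta> / (exp (x * \<delta>) - 1)"
      using xd by (simp add: exp_minus field_simps)
    moreover have "\<rho> / (exp \<delta> - 1) = exp (- \<delta>)"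
      using \<delta> by (simp add: \<rho>_def exp_minus field_simps)
    then have "\<rho> * \<delta> * g \<delta> = \<rho> - exp (- \<delta>) * \<delta>"
      using \<delta> by (simp add: g_def right_diff_distrib) (metis mult.commute times_divide_eq_right)
    moreover have "\<rho> * \<delta> * g (x * \<delta>) = \<rho> / x - \<rho> * (\<delta> / (exp (x * \<delta>) - 1))"
      using \<delta> x by (simp add: g_def right_diff_distrib)
    moreover have "\<rho> * (1 - 1 / x) = \<rho> - \<rho> / x" by (simp add: right_diff_distrib)
    ultimately have "\<rho> * (1 - 1 / x) - exp (- \<delta>) * \<delta> +
        \<rho> * (\<delta> * exp (- (x * \<delta>)) / (1 - exp (- (x * \<delta>)))) = \<rho> * \<delta> * g \<delta> - \<rho> * \<delta> * g (x * \<delta>)"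
      by simp
    with D have "(F has_real_derivative \<rho> * \<delta> * g \<delta> - \<rho> * \<delta> * g (x * \<delta>)) (at x)"
      by (rule DERIV_cong)
    then show ?thesis by (simp only: right_diff_distrib)
  qed
  have "F 1 \<le> F r"
  proof (cases "r \<ge> 1")
    case True
    show ?thesis
    proof (rule DERIV_nonneg_imp_nondecreasing[OF True])
      fix x :: real assume "1 \<le> x" "x \<le> r"
      then have "g (x * \<delta>) \<le> g \<delta>" "x > 0"
        using inverse_diff_exp_antimono[of \<delta> "x * \<delta>"] \<delta> by (auto simp: g_def)
      then show "\<exists>y. (F has_real_derivative y) (at x) \<and> 0 \<le> y"
        using deriv[of x] \<rho> \<delta> by (intro exI[of _ "\<rho> * \<delta> * (g \<delta> - g (x * \<delta>))"]) auto
    qed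
  next
    case False
    then have le: "r \<le> 1" by simp
    show ?thesis
    proof (rule DERIV_nonpos_imp_nonincreasing[OF le])
      fix x :: real assume "r \<le> x" "x \<le> 1"
      then have "g \<delta> \<le> g (x * \<delta>)" "x > 0"
        using inverse_diff_exp_antimono[of "x * \<delta>" \<delta>] \<delta> r by (auto simp: g_def mult_left_le_one_le)
      then show "\<exists>y. (F has_real_derivative y) (at x) \<and> y \<le> 0"
        using deriv[of x] \<rho> \<delta> by (intro exI[of _ "\<rho> * \<delta> * (g \<delta> - g (x * \<delta>))"])
          (auto intro!: mult_nonneg_nonpos)
    qed
  qed
  moreover have "F 1 = \<rho> * ln \<rho>" by (simp add: F_def flip: \<rho>_def)
  ultimately have "\<rho> * ln \<rho> \<le> F r" by (simp only:)
  moreover have "1 - exp (- (r * \<delta>)) > 0" using r \<delta> by simp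
  then have "ln (\<rho> / (1 - exp (- (r * \<delta>)))) = ln \<rho> - ln (1 - exp (- (r * \<delta>)))"
    using \<rho> r \<delta> by (simp add: ln_div)
  ultimately show ?thesis by (simp add: F_def right_diff_distrib del: mult_cancel_left)
qed

section \<open>Log-sum inequality and chain rule for relative entropy\<close>

lemma sum_posE:
  fixes a :: "'a \<Rightarrow> real"
  assumes "sum a X > 0" and "\<And>x. x \<in> X \<Longrightarrow> a x \<ge> 0"
  obtains x where "x \<in> X" "a x > 0"
  using assms by (metis less_eq_real_def less_irrefl sum.neutral)

text \<open>The tangent bound ln z <= z - 1 is applied termwise at z = (b x / a x) (A / B), with A
  and B the two totals.\<close>

lemma log_sum_ge:
  fixes a b :: "'a \<Rightarrow> real"
  assumes "finite X" and a: "\<And>x. x \<in> X \<Longrightarrow> a x \<ge> 0" and b: "\<And>x. x \<in> X \<Longrightarrow> b x \<ge> 0"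
    and ab: "\<And>x. x \<in> X \<Longrightarrow> a x > 0 \<Longrightarrow> b x > 0"
  shows "sum a X * ln (sum a X / sum b X) \<le> (\<Sum>x\<in>X. a x * ln (a x / b x))"
proof (cases "sum a X > 0")
  case False
  then have "sum a X = 0" using sum_nonneg[of X a] a by force
  then have "\<forall>x\<in>X. a x = 0" using a assms(1) by (simp add: sum_nonneg_eq_0_iff)
  then show ?thesis by simp
next
  case True
  define A B where "A = sum a X" and "B = sum b X"
  have A: "A > 0" using True by (simp add: A_def)
  obtain x0 where "x0 \<in> X" "a x0 > 0"
    using True a by (rule sum_posE)
  then have B: "B > 0" unfolding B_def using assms(1) b ab by (intro sum_pos2[of X x0]) auto
  \<comment> \<open>After summation the linear terms cancel, because A - B (A / B) = 0.\<close>
  have "a x * ln (A / B) + a x - b x * (A / B) \<le> a x * ln (a x / b x)" if x: "x \<in> X" for x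
  proof (cases "a x > 0")
    case False
    then have "a x = 0" using a x by force
    then show ?thesis using b[OF x] A B by simp
  next
    case True
    then have bp: "b x > 0" using ab x by simp
    have "ln (b x * A / (a x * B)) \<le> b x * A / (a x * B) - 1"
      using True A B bp by (intro ln_le_minus_one) simp
    moreover have "ln (b x * A / (a x * B)) = ln (A / B) - ln (a x / b x)"
      using True A B bp by (simp add: ln_div ln_mult)
    ultimately have "a x * (ln (A / B) - ln (a x / b x)) \<le> a x * (b x * A / (a x * B) - 1)"
      using True by (intro mult_left_mono) auto
    also have "\<dots> = b x * (A / B) - a x" using True B by (simp add: field_simps)
    finally show ?thesis by (simp add: algebra_simps)
  qed
  then have "(\<Sum>x\<in>X. a x * ln (A / B) + a x - b x * (A / B)) \<le> (\<Sum>x\<in>X. a x * ln (a x / b x))"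
    by (rule sum_mono)
  moreover have "(\<Sum>x\<in>X. a x * ln (A / B) + a x - b x * (A / B)) = A * ln (A / B) + A - B * (A / B)"
    by (simp only: sum.distrib sum_subtractf A_def B_def flip: sum_distrib_right)
  ultimately show ?thesis using B by (simp add: A_def B_def)
qed

text \<open>\<open>\<pi> y x\<close> couples the next state y with the current state x. Merging all
  pairs with the same y can only lower relative entropy, by \<open>log_sum_ge\<close>, and the
  relative entropy of the pairs splits into that of x and that of the kernels. Positivity is a
  separate conclusion because these sums of logarithms are relative entropies only under absolute
  continuity.\<close>

lemma KL_chain_step:
  fixes \<pi> :: "'a \<Rightarrow> 'a \<Rightarrow> real" and p :: "'a \<Rightarrow> real" and K :: "'a \<Rightarrow> 'a \<Rightarrow> real"
  assumes X: "finite X"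
    and \<pi>: "\<And>x y. x \<in> X \<Longrightarrow> y \<in> X \<Longrightarrow> \<pi> y x \<ge> 0"
    and q': "\<And>y. y \<in> X \<Longrightarrow> (\<Sum>x\<in>X. \<pi> y x) = q' y"
    and q: "\<And>x. x \<in> X \<Longrightarrow> (\<Sum>y\<in>X. \<pi> y x) = q x"
    and p: "\<And>x. x \<in> X \<Longrightarrow> p x \<ge> 0"
    and K: "\<And>x y. x \<in> X \<Longrightarrow> y \<in> X \<Longrightarrow> K x y \<ge> 0"
    and qp: "\<And>x. x \<in> X \<Longrightarrow> q x > 0 \<Longrightarrow> p x > 0"
    and \<pi>K: "\<And>x y. x \<in> X \<Longrightarrow> y \<in> X \<Longrightarrow> \<pi> y x > 0 \<Longrightarrow> K x y > 0"
    and p': "\<And>y. y \<in> X \<Longrightarrow> p' y = (\<Sum>x\<in>X. p x * K x y)"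
  shows "\<And>y. y \<in> X \<Longrightarrow> q' y > 0 \<Longrightarrow> p' y > 0"
    and "(\<Sum>y\<in>X. q' y * ln (q' y / p' y)) \<le> (\<Sum>x\<in>X. q x * ln (q x / p x)) +
           (\<Sum>y\<in>X. \<Sum>x\<in>X. \<pi> y x * ln (\<pi> y x / (q x * K x y)))"
proof -
  have qpos: "q x > 0" if "x \<in> X" "y \<in> X" "\<pi> y x > 0" for x y
    unfolding q[OF that(1), symmetric] using that X \<pi> by (intro sum_pos2[of X y]) auto
  have pK: "p x * K x y > 0" if "x \<in> X" "y \<in> X" "\<pi> y x > 0" for x y
    using that qp \<pi>K qpos by simp
  show "p' y > 0" if y: "y \<in> X" and y': "q' y > 0" for y
  proof -
    obtain x where "x \<in> X" "\<pi> y x > 0"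
      using sum_posE[of "\<pi> y" X] y' q'[OF y] \<pi>[OF _ y] by auto
    then show ?thesis
      unfolding p'[OF y] using pK y X p K by (intro sum_pos2[of X x]) auto
  qed
  have "(\<Sum>y\<in>X. q' y * ln (q' y / p' y)) \<le> (\<Sum>y\<in>X. \<Sum>x\<in>X. \<pi> y x * ln (\<pi> y x / (p x * K x y)))"
  proof (rule sum_mono)
    fix y assume y: "y \<in> X"
    show "q' y * ln (q' y / p' y) \<le> (\<Sum>x\<in>X. \<pi> y x * ln (\<pi> y x / (p x * K x y)))"
      using log_sum_ge[of X "\<pi> y" "\<lambda>x. p x * K x y"] X \<pi> y pK p K
      by (simp add: q' p')
  qed
  also have "\<dots> = (\<Sum>y\<in>X. \<Sum>x\<in>X. \<pi> y x * ln (q x / p x) + \<pi> y x * ln (\<pi> y x / (q x * K x y)))"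
  proof (intro sum.cong refl)
    fix x y assume xy: "x \<in> X" "y \<in> X"
    show "\<pi> y x * ln (\<pi> y x / (p x * K x y)) =
      \<pi> y x * ln (q x / p x) + \<pi> y x * ln (\<pi> y x / (q x * K x y))"
    proof (cases "\<pi> y x > 0")
      case True
      then have "q x > 0" "p x > 0" "K x y > 0" using xy qpos qp \<pi>K by auto
      then show ?thesis using True by (simp add: ln_div ln_mult distrib_left[symmetric])
    next
      case False
      then have "\<pi> y x = 0" using \<pi>[OF xy] by simp
      then show ?thesis by simp
    qed
  qed
  also have "\<dots> = (\<Sum>y\<in>X. \<Sum>x\<in>X. \<pi> y x * ln (q x / p x)) +
      (\<Sum>y\<in>X. \<Sum>x\<in>X. \<pi> y x * ln (\<pi> y x / (q x * K x y)))"
    by (simp add: sum.distrib)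
  also have "(\<Sum>y\<in>X. \<Sum>x\<in>X. \<pi> y x * ln (q x / p x)) = (\<Sum>x\<in>X. q x * ln (q x / p x))"
    by (subst sum.swap) (simp add: sum_distrib_right[symmetric] q)
  finally show "(\<Sum>y\<in>X. q' y * ln (q' y / p' y)) \<le> (\<Sum>x\<in>X. q x * ln (q x / p x)) +
           (\<Sum>y\<in>X. \<Sum>x\<in>X. \<pi> y x * ln (\<pi> y x / (q x * K x y)))" .
qed

section \<open>Sums over states\<close>

lemma finite_vocab [simp]: "finite (vocab S)"
  by (simp add: vocab_def)

lemma None_in_vocab [simp]: "None \<in> vocab S"
  by (simp add: vocab_def)

lemma Some_in_vocab [simp]: "Some a \<in> vocab S \<longleftrightarrow> 1 \<le> a \<and> a \<le> S"
  by (auto simp: vocab_def)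

lemma sum_vocab: "(\<Sum>c\<in>vocab S. g c) = g None + (\<Sum>a\<in>{1..S}. g (Some a))"
  unfolding vocab_def by (subst sum.insert) (auto simp: sum.reindex)

lemma finite_states [simp]: "finite (states d S)"
proof -
  have "finite {x. set x \<subseteq> vocab S \<and> length x = d}"
    by (rule finite_lists_length_eq) simp
  then show ?thesis by (rule rev_finite_subset) (auto simp: states_def)
qed

lemma data_states_subset: "data_states d S \<subseteq> states d S"
  by (auto simp: data_states_def states_def vocab_def)

lemma finite_data_states [simp]: "finite (data_states d S)"
  using data_states_subset finite_states by (rule finite_subset)

lemma length_states [simp]: "x \<in> states d S \<Longrightarrow> length x = d"
  by (simp add: states_def)

lemma nth_states [simp]: "x \<in> states d S \<Longrightarrow> i < d \<Longrightarrow> x ! i \<in> vocab S"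
  unfolding states_def by (metis (mono_tags, lifting) mem_Collect_eq nth_mem subsetD)

lemma update_states [simp]: "x \<in> states d S \<Longrightarrow> c \<in> vocab S \<Longrightarrow> x[i := c] \<in> states d S"
  using set_update_subset_insert[of x i c] unfolding states_def
  by (simp, blast)

lemma nth_data_states:
  assumes "z \<in> data_states d S" "i < d"
  obtains a where "z ! i = Some a" "a \<in> {1..S}"
proof -
  have "z ! i \<in> Some ` {1..S}"
    using assms nth_mem[of i z] unfolding data_states_def by blast
  then show thesis using that by blast
qed

lemma states_Suc: "states (Suc d) S = (\<lambda>(x, c). x @ [c]) ` (states d S \<times> vocab S)"
proof (intro equalityI subsetI)
  fix y assume y: "y \<in> states (Suc d) S"
  then have "y \<noteq> []" unfolding states_def by force
  have "set (butlast y) \<subseteq> set y" by (meson in_set_butlastD subsetI)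
  then have "butlast y \<in> states d S" "last y \<in> vocab S"
    using y last_in_set[OF \<open>y \<noteq> []\<close>] unfolding states_def by (simp, blast)+
  then show "y \<in> (\<lambda>(x, c). x @ [c]) ` (states d S \<times> vocab S)"
    using \<open>y \<noteq> []\<close> by (intro image_eqI[of _ _ "(butlast y, last y)"]) simp_all
next
  fix y assume "y \<in> (\<lambda>(x, c). x @ [c]) ` (states d S \<times> vocab S)"
  then obtain x c where "y = x @ [c]" "x \<in> states d S" "c \<in> vocab S" by auto
  then show "y \<in> states (Suc d) S" unfolding states_def by simp
qed

text \<open>Distributivity. It reduces sums of product laws over all states to one-coordinate
  sums.\<close>

lemma sum_states_prod:
  fixes g :: "nat \<Rightarrow> nat option \<Rightarrow> real"
  shows "(\<Sum>x\<in>states d S. \<Prod>i<d. g i (x ! i)) = (\<Prod>i<d. \<Sum>c\<in>vocab S. g i c)"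
proof (induction d)
  case 0
  have "states 0 S = {[]}" unfolding states_def by force
  then show ?case by simp
next
  case (Suc d)
  have inj: "inj_on (\<lambda>(x, c). x @ [c]) (states d S \<times> vocab S)"
    by (auto simp: inj_on_def)
  have "(\<Sum>x\<in>states (Suc d) S. \<Prod>i<Suc d. g i (x ! i)) =
        (\<Sum>(x, c)\<in>states d S \<times> vocab S. (\<Prod>i<d. g i (x ! i)) * g d c)"
    unfolding states_Suc sum.reindex[OF inj]
    by (intro sum.cong refl) (auto simp: nth_append intro!: prod.cong)
  also have "\<dots> = (\<Sum>x\<in>states d S. \<Prod>i<d. g i (x ! i)) * (\<Sum>c\<in>vocab S. g d c)"
    by (simp add: sum.cartesian_product[symmetric] sum_product)
  finally show ?case using Suc by simp
qed

lemma sum_states_prod_coord: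
  fixes g :: "nat \<Rightarrow> nat option \<Rightarrow> real"
  assumes i: "i < d"
  shows "(\<Sum>x\<in>states d S. \<phi> (x ! i) * (\<Prod>j<d. g j (x ! j))) =
    (\<Sum>c\<in>vocab S. \<phi> c * g i c) * (\<Prod>j\<in>{..<d}-{i}. \<Sum>c\<in>vocab S. g j c)"
proof -
  \<comment> \<open>The test function of coordinate i is absorbed into the i-th factor, which
    restores a pure product.\<close>
  define g' where "g' j c = (if j = i then \<phi> c else 1) * g j c" for j c
  have "(\<Prod>j<d. g' j (x ! j)) = \<phi> (x ! i) * (\<Prod>j<d. g j (x ! j))" for x
    using i by (simp add: g'_def prod.distrib prod.delta)
  then have "(\<Sum>x\<in>states d S. \<phi> (x ! i) * (\<Prod>j<d. g j (x ! j))) = (\<Prod>j<d. \<Sum>c\<in>vocab S. g' j c)"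
    by (simp flip: sum_states_prod)
  also have "\<dots> = (\<Sum>c\<in>vocab S. g' i c) * (\<Prod>j\<in>{..<d}-{i}. \<Sum>c\<in>vocab S. g' j c)"
    using i by (intro prod.remove) auto
  also have "(\<Prod>j\<in>{..<d}-{i}. \<Sum>c\<in>vocab S. g' j c) = (\<Prod>j\<in>{..<d}-{i}. \<Sum>c\<in>vocab S. g j c)"
    by (intro prod.cong refl) (auto simp: g'_def)
  finally show ?thesis by (simp add: g'_def)
qed

text \<open>A state is determined by its version masked at i and its value at i, so the states
  masked at i index the fibers of that coordinate.\<close>

lemma sum_states_split:
  fixes g :: "state \<Rightarrow> real"
  assumes i: "i < d"
  shows "(\<Sum>x\<in>states d S. g x) = (\<Sum>x\<in>{x\<in>states d S. x ! i = None}. \<Sum>c\<in>vocab S. g (x[i := c]))"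
proof -
  have "(\<Sum>x\<in>{x\<in>states d S. x ! i = None}. \<Sum>c\<in>vocab S. g (x[i := c])) =
        (\<Sum>(x, c)\<in>{x\<in>states d S. x ! i = None} \<times> vocab S. g (x[i := c]))"
    by (simp add: sum.cartesian_product)
  also have "\<dots> = (\<Sum>x\<in>states d S. g x)"
    by (rule sum.reindex_bij_witness[where i = "\<lambda>x. (x[i := None], x ! i)" and j = "\<lambda>(x, c). x[i := c]"])
       (use i in \<open>auto simp: list_update_same_conv[symmetric]\<close>)
  finally show ?thesis ..
qed

lemma sum_unmasked_reindex:
  fixes g :: "state \<Rightarrow> real"
  assumes i: "i < d"
  shows "(\<Sum>x\<in>{x\<in>states d S. x ! i \<noteq> None}. g x) =
    (\<Sum>x\<in>{x\<in>states d S. x ! i = None}. \<Sum>a\<in>{1..S}. g (x[i := Some a]))"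
proof -
  have "(\<Sum>x\<in>{x\<in>states d S. x ! i \<noteq> None}. g x) = (\<Sum>x\<in>states d S. if x ! i \<noteq> None then g x else 0)"
    by (simp add: sum.inter_filter)
  also have "\<dots> = (\<Sum>x\<in>{x\<in>states d S. x ! i = None}. \<Sum>a\<in>{1..S}. g (x[i := Some a]))"
    unfolding sum_states_split[OF i] sum_vocab using i by (intro sum.cong refl) auto
  finally show ?thesis .
qed

section \<open>The masking process\<close>

text \<open>Law of one coordinate started at an unmasked value z; only for such z is the total mass
  1. The full transition kernel, with the mask absorbing, is \<open>remask\<close>.\<close>

definition coord_law :: "real \<Rightarrow> nat option \<Rightarrow> nat option \<Rightarrow> real" where
  "coord_law t z c = (if c = None then 1 - exp (- t) else if c = z then exp (- t) else 0)"

definition remask :: "real \<Rightarrow> nat option \<Rightarrow> nat option \<Rightarrow> real" where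
  "remask h b c = (if b = None then (if c = None then 1 else 0) else coord_law h b c)"

definition coord_weight :: "real \<Rightarrow> nat option \<Rightarrow> real" where
  "coord_weight t c = (if c = None then 1 - exp (- t) else exp (- t))"

text \<open>The event of agreement with x is written as a product of indicators, in the shape of the
  density itself, so that \<open>mask_law_factor\<close> holds factor by factor.\<close>

definition revealed_marginal :: "nat \<Rightarrow> nat \<Rightarrow> (state \<Rightarrow> real) \<Rightarrow> state \<Rightarrow> real" where
  "revealed_marginal d S q0 x =
     (\<Sum>z\<in>data_states d S. q0 z * (\<Prod>i<d. if x ! i = None \<or> x ! i = z ! i then 1 else 0))"

definition rest_law :: "nat \<Rightarrow> real \<Rightarrow> nat \<Rightarrow> state \<Rightarrow> state \<Rightarrow> real" where
  "rest_law d t i z x = (\<Prod>j\<in>{..<d}-{i}. coord_law t (z ! j) (x ! j))"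

lemma sum_Some_delta:
  fixes \<phi> :: "nat option \<Rightarrow> real"
  assumes "z \<in> Some ` {1..S}"
  shows "(\<Sum>a\<in>{1..S}. if Some a = z then \<phi> (Some a) else 0) = \<phi> z"
proof -
  obtain b where b: "z = Some b" "b \<in> {1..S}" using assms by auto
  then have "(\<Sum>a\<in>{1..S}. if Some a = z then \<phi> (Some a) else 0) =
      (\<Sum>a\<in>{1..S}. if a = b then \<phi> (Some a) else 0)"
    by (intro sum.cong) auto
  then show ?thesis using b by (simp add: sum.delta')
qed

lemma sum_coord_law_Some:
  fixes \<phi> :: "nat option \<Rightarrow> real"
  assumes "z \<in> Some ` {1..S}"
  shows "(\<Sum>a\<in>{1..S}. \<phi> (Some a) * coord_law t z (Some a)) = \<phi> z * exp (- t)"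
  using sum_Some_delta[OF assms, of "\<lambda>c. \<phi> c * exp (- t)"]
  by (simp add: coord_law_def if_distrib cong: if_cong)

lemma sum_coord_law: "z \<in> Some ` {1..S} \<Longrightarrow> (\<Sum>c\<in>vocab S. coord_law t z c) = 1"
  using sum_coord_law_Some[of z S "\<lambda>_. 1" t] by (simp add: sum_vocab coord_law_def)

lemma sum_remask: "b \<in> vocab S \<Longrightarrow> (\<Sum>c\<in>vocab S. remask h b c) = 1"
  by (cases b) (auto simp: remask_def sum_coord_law sum_vocab[of "\<lambda>c. if c = None then 1 else 0"])

text \<open>Chapman-Kolmogorov for one coordinate: a symbol survives until u + h if it survives both
  intervals, which are independent.\<close>

lemma sum_coord_law_remask:
  assumes z: "z \<in> Some ` {1..S}" and c: "c \<in> vocab S"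
  shows "(\<Sum>b\<in>vocab S. coord_law u z b * remask h b c) = coord_law (u + h) z c"
proof -
  have "(\<Sum>a\<in>{1..S}. coord_law u z (Some a) * remask h (Some a) c) = exp (- u) * coord_law h z c"
    using sum_coord_law_Some[OF z, of "\<lambda>b. remask h b c" u] z by (auto simp: mult.commute remask_def)
  then show ?thesis
    by (cases c) (auto simp: sum_vocab coord_law_def remask_def exp_add[symmetric] algebra_simps)
qed

lemma mask_law_eq: "mask_law d S q0 t x = (\<Sum>z\<in>data_states d S. q0 z * (\<Prod>i<d. coord_law t (z ! i) (x ! i)))"
  by (simp add: mask_law_def coord_law_def)

lemma mask_law_update:
  assumes "i < d" "length x = d"
  shows "mask_law d S q0 t (x[i := c]) =
    (\<Sum>z\<in>data_states d S. q0 z * (coord_law t (z ! i) c * rest_law d t i z x))"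
proof -
  have "(\<Prod>j<d. coord_law t (z ! j) (x[i := c] ! j)) = coord_law t (z ! i) c * rest_law d t i z x" for z
  proof -
    have "(\<Prod>j<d. coord_law t (z ! j) (x[i := c] ! j)) =
       coord_law t (z ! i) (x[i := c] ! i) * (\<Prod>j\<in>{..<d}-{i}. coord_law t (z ! j) (x[i := c] ! j))"
      using assms by (intro prod.remove) auto
    also have "(\<Prod>j\<in>{..<d}-{i}. coord_law t (z ! j) (x[i := c] ! j)) = rest_law d t i z x"
      unfolding rest_law_def by (intro prod.cong) auto
    finally show ?thesis using assms by simp
  qed
  then show ?thesis by (simp add: mask_law_eq)
qed

lemma coord_law_weight: "coord_law t z c = coord_weight t c * (if c = None \<or> c = z then 1 else 0)"
  by (simp add: coord_law_def coord_weight_def)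

text \<open>All dependence on time sits in the weights, which see only the mask pattern, and all
  dependence on the data law sits in the time-independent marginal.\<close>

lemma mask_law_factor:
  "mask_law d S q0 t x = (\<Prod>i<d. coord_weight t (x ! i)) * revealed_marginal d S q0 x"
  unfolding mask_law_eq revealed_marginal_def coord_law_weight
  by (simp add: prod.distrib sum_distrib_left mult.left_commute)

text \<open>Summing over the symbols at i selects the data symbol and leaves its survival
  probability exp (-t). With \<phi> = 1 and \<open>mask_law_masked\<close> it follows that, for t >
  0 and at a state of positive mass, the true scores of a masked coordinate add up to 1 / (exp t -
  1), whatever the data law is.\<close>

lemma sum_mask_law_Some:
  assumes i: "i < d" and x: "x \<in> states d S"
  shows "(\<Sum>a\<in>{1..S}. \<phi> (Some a) * mask_law d S q0 t (x[i := Some a])) =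
    exp (- t) * (\<Sum>z\<in>data_states d S. q0 z * (\<phi> (z ! i) * rest_law d t i z x))"
proof -
  have "(\<Sum>a\<in>{1..S}. \<phi> (Some a) * mask_law d S q0 t (x[i := Some a])) =
    (\<Sum>z\<in>data_states d S. q0 z * rest_law d t i z x * (\<Sum>a\<in>{1..S}. \<phi> (Some a) * coord_law t (z ! i) (Some a)))"
    using i x by (simp add: mask_law_update sum_distrib_left) (subst sum.swap, simp add: mult_ac)
  also have "\<dots> = (\<Sum>z\<in>data_states d S. q0 z * rest_law d t i z x * (\<phi> (z ! i) * exp (- t)))"
  proof (intro sum.cong refl)
    fix z assume "z \<in> data_states d S"
    then have "z ! i \<in> Some ` {1..S}" using i by (auto elim: nth_data_states)
    then show "q0 z * rest_law d t i z x * (\<Sum>a\<in>{1..S}. \<phi> (Some a) * coord_law t (z ! i) (Some a)) =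
      q0 z * rest_law d t i z x * (\<phi> (z ! i) * exp (- t))"
      by (simp only: sum_coord_law_Some)
  qed
  finally show ?thesis by (simp add: sum_distrib_left mult_ac)
qed

lemma mask_law_masked:
  assumes i: "i < d" and x: "length x = d" "x ! i = None"
  shows "mask_law d S q0 t x = (1 - exp (- t)) * (\<Sum>z\<in>data_states d S. q0 z * rest_law d t i z x)"
  using mask_law_update[OF i x(1), of S q0 t None] x(2)
  by (simp add: coord_law_def sum_distrib_left mult_ac list_update_same_conv[THEN iffD2] i x(1))

text \<open>Every data point carries exactly one symbol at i, so the events on the left partition
  the event on the right.\<close>

lemma revealed_marginal_sum:
  assumes i: "i < d" and x: "x \<in> states d S"
  shows "(\<Sum>a\<in>{1..S}. revealed_marginal d S q0 (x[i := Some a])) = revealed_marginal d S q0 (x[i := None])"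
proof -
  have split: "revealed_marginal d S q0 (x[i := c]) =
      (\<Sum>z\<in>data_states d S. q0 z * (\<Prod>j\<in>{..<d}-{i}. if x ! j = None \<or> x ! j = z ! j then 1 else 0) *
        (if c = None \<or> c = z ! i then 1 else 0))" for c
    unfolding revealed_marginal_def
  proof (intro sum.cong refl)
    fix z
    have "(\<Prod>j<d. if x[i := c] ! j = None \<or> x[i := c] ! j = z ! j then 1 else 0 :: real) =
      (if x[i := c] ! i = None \<or> x[i := c] ! i = z ! i then 1 else 0) *
      (\<Prod>j\<in>{..<d}-{i}. if x[i := c] ! j = None \<or> x[i := c] ! j = z ! j then 1 else 0)"
      using i by (intro prod.remove) auto
    also have "(\<Prod>j\<in>{..<d}-{i}. if x[i := c] ! j = None \<or> x[i := c] ! j = z ! j then 1 else 0 :: real)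
      = (\<Prod>j\<in>{..<d}-{i}. if x ! j = None \<or> x ! j = z ! j then 1 else 0)"
      by (intro prod.cong) auto
    finally show "q0 z * (\<Prod>j<d. if x[i := c] ! j = None \<or> x[i := c] ! j = z ! j then 1 else 0) =
      q0 z * (\<Prod>j\<in>{..<d}-{i}. if x ! j = None \<or> x ! j = z ! j then 1 else 0) *
        (if c = None \<or> c = z ! i then 1 else 0)"
      using i x by simp
  qed
  have "(\<Sum>a\<in>{1..S}. revealed_marginal d S q0 (x[i := Some a])) =
     (\<Sum>z\<in>data_states d S. q0 z * (\<Prod>j\<in>{..<d}-{i}. if x ! j = None \<or> x ! j = z ! j then 1 else 0) *
        (\<Sum>a\<in>{1..S}. if Some a = z ! i then 1 else 0))"
    unfolding split by (simp add: sum_distrib_left) (rule sum.swap)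
  also have "\<dots> = revealed_marginal d S q0 (x[i := None])"
    unfolding split
  proof (intro sum.cong refl)
    fix z assume "z \<in> data_states d S"
    then have "z ! i \<in> Some ` {1..S}" using i by (auto elim: nth_data_states)
    then show "q0 z * (\<Prod>j\<in>{..<d}-{i}. if x ! j = None \<or> x ! j = z ! j then 1 else 0) *
        (\<Sum>a\<in>{1..S}. if Some a = z ! i then 1 else 0) =
      q0 z * (\<Prod>j\<in>{..<d}-{i}. if x ! j = None \<or> x ! j = z ! j then 1 else 0) *
        (if None = None \<or> None = z ! i then 1 else 0)"
      using sum_Some_delta[of "z ! i" S "\<lambda>_. 1"] by simp
  qed
  finally show ?thesis .
qed

lemma update_None_id [simp]: "x ! i = None \<Longrightarrow> x[i := None] = x"
  by (metis list_update_id)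

lemma sum_masked_filter:
  fixes g :: "state \<Rightarrow> real"
  shows "(\<Sum>x\<in>{x\<in>states d S. x ! i = None}. g x) = (\<Sum>x\<in>states d S. if x ! i = None then g x else 0)"
  by (rule sum.inter_filter) simp

lemma sum_unmasked_filter:
  fixes g :: "state \<Rightarrow> real"
  shows "(\<Sum>x\<in>{x\<in>states d S. x ! i \<noteq> None}. g x) = (\<Sum>x\<in>states d S. if x ! i = None then 0 else g x)"
  by (subst sum.inter_filter) (auto intro: sum.cong)

section \<open>The process at two times\<close>

text \<open>Law of the state y at time u together with the state x at the noisier time u + h. The
  cleaner state comes first, as in \<open>KL_chain_step\<close>, since the algorithm moves from x to
  y.\<close>

definition joint_law :: "nat \<Rightarrow> nat \<Rightarrow> (state \<Rightarrow> real) \<Rightarrow> real \<Rightarrow> real \<Rightarrow> state \<Rightarrow> state \<Rightarrow> real" where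
  "joint_law d S q0 u h y x = mask_law d S q0 u y * (\<Prod>i<d. remask h (y ! i) (x ! i))"

lemma sum_joint_law_left:
  assumes "y \<in> states d S"
  shows "(\<Sum>x\<in>states d S. joint_law d S q0 u h y x) = mask_law d S q0 u y"
  using assms sum_states_prod[of "\<lambda>i. remask h (y ! i)" d S]
  by (simp add: joint_law_def sum_remask flip: sum_distrib_left)

lemma joint_law_eq:
  "joint_law d S q0 u h y x =
    (\<Sum>z\<in>data_states d S. q0 z * (\<Prod>i<d. coord_law u (z ! i) (y ! i) * remask h (y ! i) (x ! i)))"
  by (simp add: joint_law_def mask_law_eq sum_distrib_right prod.distrib mult.assoc)

text \<open>Given the data point the coordinates are independent, so each coordinate other than i
  integrates out by Chapman-Kolmogorov.\<close>

lemma sum_coord_joint_law: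
  assumes i: "i < d" and x: "x \<in> states d S"
  shows "(\<Sum>y\<in>states d S. \<phi> (y ! i) * joint_law d S q0 u h y x) =
    (\<Sum>z\<in>data_states d S. q0 z * ((\<Sum>c\<in>vocab S. \<phi> c * (coord_law u (z ! i) c * remask h c (x ! i))) *
       rest_law d (u + h) i z x))"
proof -
  have "(\<Sum>y\<in>states d S. \<phi> (y ! i) * joint_law d S q0 u h y x) =
    (\<Sum>z\<in>data_states d S. q0 z * (\<Sum>y\<in>states d S. \<phi> (y ! i) *
       (\<Prod>j<d. coord_law u (z ! j) (y ! j) * remask h (y ! j) (x ! j))))"
    unfolding joint_law_eq sum_distrib_left by (subst sum.swap) (simp add: mult.left_commute)
  also have "\<dots> = (\<Sum>z\<in>data_states d S. q0 z * ((\<Sum>c\<in>vocab S. \<phi> c * (coord_law u (z ! i) c * remask h c (x ! i))) *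
       rest_law d (u + h) i z x))"
  proof (intro sum.cong refl arg_cong2[where f = "(*)"])
    fix z assume z: "z \<in> data_states d S"
    have "(\<Prod>j\<in>{..<d}-{i}. \<Sum>c\<in>vocab S. coord_law u (z ! j) c * remask h c (x ! j)) =
          rest_law d (u + h) i z x"
      unfolding rest_law_def
    proof (intro prod.cong refl sum_coord_law_remask)
      fix j assume j: "j \<in> {..<d}-{i}"
      then show "z ! j \<in> Some ` {1..S}" using z by (auto elim: nth_data_states)
      show "x ! j \<in> vocab S" using j x by simp
    qed
    then show "(\<Sum>y\<in>states d S. \<phi> (y ! i) * (\<Prod>j<d. coord_law u (z ! j) (y ! j) * remask h (y ! j) (x ! j))) =
      (\<Sum>c\<in>vocab S. \<phi> c * (coord_law u (z ! i) c * remask h c (x ! i))) * rest_law d (u + h) i z x"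
      using sum_states_prod_coord[OF i, of \<phi> "\<lambda>j c. coord_law u (z ! j) c * remask h c (x ! j)" S] by simp
  qed
  finally show ?thesis .
qed

lemma sum_joint_law_right:
  assumes x: "x \<in> states d S"
  shows "(\<Sum>y\<in>states d S. joint_law d S q0 u h y x) = mask_law d S q0 (u + h) x"
proof -
  have "(\<Sum>y\<in>states d S. joint_law d S q0 u h y x) =
    (\<Sum>z\<in>data_states d S. q0 z * (\<Prod>i<d. \<Sum>c\<in>vocab S. coord_law u (z ! i) c * remask h c (x ! i)))"
    unfolding joint_law_eq sum_states_prod[symmetric] sum_distrib_left by (rule sum.swap)
  also have "\<dots> = mask_law d S q0 (u + h) x"
    unfolding mask_law_eq
  proof (intro sum.cong refl arg_cong2[where f = "(*)"] prod.cong sum_coord_law_remask)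
    fix z i assume "z \<in> data_states d S" "i \<in> {..<d}"
    then show "z ! i \<in> Some ` {1..S}" "x ! i \<in> vocab S" using x by (auto elim: nth_data_states)
  qed
  finally show ?thesis .
qed

text \<open>A coordinate masked at u + h was either masked already at u or lost its symbol in
  between. In the second case exp (-u) (1 - exp (-h)) = (exp h - 1) exp (-(u + h)) expresses the
  probability through the law at u + h alone; this is the origin of the factor exp h - 1 in the
  error bound.\<close>

lemma sum_masked_joint_law:
  assumes i: "i < d" and x: "x \<in> states d S" "x ! i = None" and uh: "u + h > 0"
  shows "(\<Sum>y\<in>states d S. \<phi> (y ! i) * joint_law d S q0 u h y x) =
    \<phi> None * ((1 - exp (- u)) / (1 - exp (- (u + h)))) * mask_law d S q0 (u + h) x +
    (exp h - 1) * (\<Sum>a\<in>{1..S}. \<phi> (Some a) * mask_law d S q0 (u + h) (x[i := Some a]))"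
proof -
  let ?R = "\<lambda>z. rest_law d (u + h) i z x"
  have c: "(\<Sum>c\<in>vocab S. \<phi> c * (coord_law u (z ! i) c * remask h c (x ! i))) =
      \<phi> None * (1 - exp (- u)) + \<phi> (z ! i) * (exp (- u) * (1 - exp (- h)))"
    if "z \<in> data_states d S" for z
  proof -
    have z: "z ! i \<in> Some ` {1..S}" using that i by (auto elim: nth_data_states)
    have "(\<Sum>a\<in>{1..S}. \<phi> (Some a) * (coord_law u (z ! i) (Some a) * remask h (Some a) (x ! i))) =
      (\<Sum>a\<in>{1..S}. \<phi> (Some a) * coord_law u (z ! i) (Some a)) * (1 - exp (- h))"
      using x(2) by (simp add: remask_def coord_law_def sum_distrib_right mult.assoc)
    then show ?thesis
      unfolding sum_vocab sum_coord_law_Some[OF z] using x(2) by (simp add: remask_def coord_law_def)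
  qed
  have "(\<Sum>y\<in>states d S. \<phi> (y ! i) * joint_law d S q0 u h y x) =
    (\<Sum>z\<in>data_states d S. q0 z * ((\<phi> None * (1 - exp (- u)) + \<phi> (z ! i) * (exp (- u) * (1 - exp (- h)))) * ?R z))"
    unfolding sum_coord_joint_law[OF i x(1)] by (intro sum.cong refl) (simp add: c)
  also have "\<dots> = \<phi> None * (1 - exp (- u)) * (\<Sum>z\<in>data_states d S. q0 z * ?R z) +
      exp (- u) * (1 - exp (- h)) * (\<Sum>z\<in>data_states d S. q0 z * (\<phi> (z ! i) * ?R z))"
    by (simp add: distrib_right distrib_left sum.distrib sum_distrib_left mult_ac)
  also have "(\<Sum>z\<in>data_states d S. q0 z * ?R z) = mask_law d S q0 (u + h) x / (1 - exp (- (u + h)))"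
    using mask_law_masked[OF i length_states[OF x(1)] x(2), of S q0 "u + h"] uh by simp
  also have "(\<Sum>z\<in>data_states d S. q0 z * (\<phi> (z ! i) * ?R z)) =
    exp (u + h) * (\<Sum>a\<in>{1..S}. \<phi> (Some a) * mask_law d S q0 (u + h) (x[i := Some a]))"
    unfolding sum_mask_law_Some[OF i x(1)] by (simp add: mult.assoc[symmetric] exp_add[symmetric])
  also have "exp (- u) * (1 - exp (- h)) * (exp (u + h) * (\<Sum>a\<in>{1..S}. \<phi> (Some a) * mask_law d S q0 (u + h) (x[i := Some a])))
    = (exp h - 1) * (\<Sum>a\<in>{1..S}. \<phi> (Some a) * mask_law d S q0 (u + h) (x[i := Some a]))"
  proof -
    have "exp (- u) * (1 - exp (- h)) * exp (u + h) = exp h - 1"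
      by (simp add: exp_add exp_minus field_simps)
    then show ?thesis by (simp only: mult.assoc[symmetric])
  qed
  finally show ?thesis by simp
qed

section \<open>The generator and the time derivative of expectations\<close>

definition mask_generator :: "nat \<Rightarrow> (state \<Rightarrow> real) \<Rightarrow> state \<Rightarrow> real" where
  "mask_generator d g x = (\<Sum>i<d. if x ! i = None then 0 else g (x[i := None]) - g x)"

definition mask_expect :: "nat \<Rightarrow> nat \<Rightarrow> (state \<Rightarrow> real) \<Rightarrow> (state \<Rightarrow> real) \<Rightarrow> real \<Rightarrow> real" where
  "mask_expect d S q0 g t = (\<Sum>x\<in>states d S. mask_law d S q0 t x * g x)"

text \<open>The forward Kolmogorov equation, from the product rule over coordinates: a masked
  coordinate receives mass from every symbol, an unmasked one loses mass at rate 1.\<close>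

lemma mask_law_has_derivative:
  assumes x: "x \<in> states d S"
  shows "((\<lambda>t. mask_law d S q0 t x) has_real_derivative
    (\<Sum>i<d. if x ! i = None then \<Sum>a\<in>{1..S}. mask_law d S q0 t (x[i := Some a]) else - mask_law d S q0 t x)) (at t)"
proof -
  define c' where "c' t z c = (if c = None then exp (- t) else if c = z then - exp (- t) else 0)"
    for t :: real and z c :: "nat option"
  have c': "((\<lambda>t. coord_law t z c) has_real_derivative c' t z c) (at t)" for z c
    unfolding coord_law_def c'_def by (auto intro!: derivative_eq_intros)
  have "((\<lambda>t. mask_law d S q0 t x) has_real_derivative
     (\<Sum>z\<in>data_states d S. q0 z * (\<Sum>i<d. c' t (z ! i) (x ! i) * rest_law d t i z x))) (at t)"
    unfolding mask_law_eq rest_law_def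
    by (intro DERIV_sum DERIV_cmult has_field_derivative_prod c')
  also have "(\<Sum>z\<in>data_states d S. q0 z * (\<Sum>i<d. c' t (z ! i) (x ! i) * rest_law d t i z x)) =
    (\<Sum>i<d. \<Sum>z\<in>data_states d S. q0 z * (c' t (z ! i) (x ! i) * rest_law d t i z x))"
    unfolding sum_distrib_left by (rule sum.swap)
  also have "\<dots> = (\<Sum>i<d. if x ! i = None then \<Sum>a\<in>{1..S}. mask_law d S q0 t (x[i := Some a]) else - mask_law d S q0 t x)"
  proof (intro sum.cong refl)
    fix i assume "i \<in> {..<d}"
    then have i: "i < d" by simp
    show "(\<Sum>z\<in>data_states d S. q0 z * (c' t (z ! i) (x ! i) * rest_law d t i z x)) =
      (if x ! i = None then \<Sum>a\<in>{1..S}. mask_law d S q0 t (x[i := Some a]) else - mask_law d S q0 t x)"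
    proof (cases "x ! i = None")
      case True
      then show ?thesis
        using sum_mask_law_Some[OF i x, of "\<lambda>_. 1" q0 t] by (simp add: c'_def sum_distrib_left mult_ac)
    next
      case False
      then obtain b where b: "x ! i = Some b" by blast
      have "c' t (z ! i) (x ! i) = - coord_law t (z ! i) (x ! i)" for z
        by (simp add: c'_def coord_law_def b)
      then show ?thesis
        using b mask_law_update[OF i length_states[OF x], of S q0 t "x ! i"] list_update_id[of x i]
        by (simp add: sum_negf)
    qed
  qed
  finally show ?thesis .
qed

text \<open>Each jump is indexed by its target, a state masked at i, and by the symbol that is lost.
  \<open>L_SE_eq\<close> brings the score entropy into the same form, so that the two can be
  compared termwise.\<close>

lemma mask_expect_generator:
  "mask_expect d S q0 (mask_generator d g) t = - (\<Sum>i<d. \<Sum>x\<in>{x\<in>states d S. x ! i = None}.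
     \<Sum>a\<in>{1..S}. mask_law d S q0 t (x[i := Some a]) * (g (x[i := Some a]) - g x))"
proof -
  have "mask_expect d S q0 (mask_generator d g) t =
    (\<Sum>i<d. \<Sum>x\<in>states d S. if x ! i = None then 0 else mask_law d S q0 t x * (g (x[i := None]) - g x))"
    unfolding mask_expect_def mask_generator_def sum_distrib_left
    by (subst sum.swap) (intro sum.cong refl, simp)
  also have "\<dots> = (\<Sum>i<d. \<Sum>x\<in>{x\<in>states d S. x ! i \<noteq> None}. mask_law d S q0 t x * (g (x[i := None]) - g x))"
    unfolding sum_unmasked_filter by (rule refl)
  also have "\<dots> = (\<Sum>i<d. \<Sum>x\<in>{x\<in>states d S. x ! i = None}.
     \<Sum>a\<in>{1..S}. mask_law d S q0 t (x[i := Some a]) * (g x - g (x[i := Some a])))"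
  proof (rule sum.cong[OF refl])
    fix i assume "i \<in> {..<d}"
    then have i: "i < d" by simp
    show "(\<Sum>x\<in>{x\<in>states d S. x ! i \<noteq> None}. mask_law d S q0 t x * (g (x[i := None]) - g x)) =
      (\<Sum>x\<in>{x\<in>states d S. x ! i = None}.
        \<Sum>a\<in>{1..S}. mask_law d S q0 t (x[i := Some a]) * (g x - g (x[i := Some a])))"
      unfolding sum_unmasked_reindex[OF i] by (intro sum.cong refl) simp
  qed
  also have "\<dots> = - (\<Sum>i<d. \<Sum>x\<in>{x\<in>states d S. x ! i = None}.
     \<Sum>a\<in>{1..S}. mask_law d S q0 t (x[i := Some a]) * (g (x[i := Some a]) - g x))"
    unfolding sum_negf[symmetric] by (intro sum.cong refl) (simp add: algebra_simps)
  finally show ?thesis .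
qed

text \<open>Dynkin's formula: the forward equation is moved onto the test function by reindexing the
  jumps.\<close>

lemma mask_expect_has_derivative:
  "((\<lambda>t. mask_expect d S q0 g t) has_real_derivative mask_expect d S q0 (mask_generator d g) t) (at t)"
proof -
  let ?q = "mask_law d S q0 t"
  let ?D = "\<lambda>x i. if x ! i = None then \<Sum>a\<in>{1..S}. ?q (x[i := Some a]) else - ?q x"
  have "(\<lambda>t. mask_expect d S q0 g t) = (\<lambda>t. \<Sum>x\<in>states d S. mask_law d S q0 t x * g x)"
    by (simp add: mask_expect_def)
  moreover have "((\<lambda>t. \<Sum>x\<in>states d S. mask_law d S q0 t x * g x) has_real_derivative
      (\<Sum>x\<in>states d S. (\<Sum>i<d. ?D x i) * g x)) (at t)"
    by (intro DERIV_sum DERIV_cmult_right mask_law_has_derivative)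
  moreover have "(\<Sum>x\<in>states d S. (\<Sum>i<d. ?D x i) * g x) = (\<Sum>i<d. \<Sum>x\<in>states d S. ?D x i * g x)"
    unfolding sum_distrib_right by (rule sum.swap)
  moreover have "(\<Sum>i<d. \<Sum>x\<in>states d S. ?D x i * g x) = mask_expect d S q0 (mask_generator d g) t"
    unfolding mask_expect_generator sum_negf[symmetric]
  proof (rule sum.cong[OF refl])
    fix i assume "i \<in> {..<d}"
    then have i: "i < d" by simp
    have "(\<Sum>x\<in>states d S. ?D x i * g x) =
      (\<Sum>x\<in>states d S. if x ! i = None then (\<Sum>a\<in>{1..S}. ?q (x[i := Some a])) * g x else 0) +
      (\<Sum>x\<in>states d S. if x ! i = None then 0 else - ?q x * g x)"
      unfolding sum.distrib[symmetric] by (intro sum.cong refl) simp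
    also have "\<dots> = (\<Sum>x\<in>{x\<in>states d S. x ! i = None}. (\<Sum>a\<in>{1..S}. ?q (x[i := Some a])) * g x) +
       (\<Sum>x\<in>{x\<in>states d S. x ! i \<noteq> None}. - ?q x * g x)"
      by (simp only: sum_masked_filter sum_unmasked_filter)
    also have "\<dots> = (\<Sum>x\<in>{x\<in>states d S. x ! i = None}. \<Sum>a\<in>{1..S}. - (?q (x[i := Some a]) * (g (x[i := Some a]) - g x)))"
      unfolding sum_unmasked_reindex[OF i] sum.distrib[symmetric]
      by (intro sum.cong refl) (simp add: sum_distrib_right right_diff_distrib sum_subtractf sum_negf)
    finally show "(\<Sum>x\<in>states d S. ?D x i * g x) = (\<Sum>x\<in>{x\<in>states d S. x ! i = None}. \<Sum>a\<in>{1..S}. - (?q (x[i := Some a]) * (g (x[i := Some a]) - g x)))" .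
  qed
  ultimately show ?thesis by simp
qed

text \<open>A discrete mixed second derivative. The alternating sum is zero anyway when i or j is
  masked, so the case distinction only makes this visible.\<close>

definition mixed_diff :: "(state \<Rightarrow> real) \<Rightarrow> nat \<Rightarrow> nat \<Rightarrow> state \<Rightarrow> real" where
  "mixed_diff g i j x = (if x ! i = None \<or> x ! j = None then 0
     else g (x[i := None, j := None]) - g (x[i := None]) - g (x[j := None]) + g x)"

text \<open>Let D_i be the operator "mask i, minus identity"; the generator is the sum of the D_i.
  Masking is idempotent, hence D_i D_i = - D_i, so the diagonal of the squared generator cancels the
  added first-order term and only D_i D_j with i and j distinct remain.\<close>

lemma mask_generator_twice:
  assumes x: "length x = d"
  shows "mask_generator d (mask_generator d g) x + mask_generator d g x =
    (\<Sum>i<d. \<Sum>j\<in>{..<d}-{i}. mixed_diff g i j x)"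
proof -
  have "(if x ! i = None then 0 else mask_generator d g (x[i := None]) - mask_generator d g x) +
        (if x ! i = None then 0 else g (x[i := None]) - g x) = (\<Sum>j\<in>{..<d}-{i}. mixed_diff g i j x)"
    if i: "i < d" for i
  proof (cases "x ! i = None")
    case True
    then show ?thesis by (simp add: mixed_diff_def)
  next
    case False
    have "mask_generator d g (x[i := None]) =
       (\<Sum>j\<in>{..<d}-{i}. if x ! j = None then 0 else g (x[i := None, j := None]) - g (x[i := None]))"
      unfolding mask_generator_def using i x
      by (subst sum.remove[of _ i]) (auto intro!: sum.cong)
    moreover have "mask_generator d g x = (g (x[i := None]) - g x) +
       (\<Sum>j\<in>{..<d}-{i}. if x ! j = None then 0 else g (x[j := None]) - g x)"
      unfolding mask_generator_def using i False by (subst sum.remove[of _ i]) auto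
    ultimately have "mask_generator d g (x[i := None]) - mask_generator d g x + (g (x[i := None]) - g x) =
      (\<Sum>j\<in>{..<d}-{i}. (if x ! j = None then 0 else g (x[i := None, j := None]) - g (x[i := None])) -
         (if x ! j = None then 0 else g (x[j := None]) - g x))"
      by (simp add: sum_subtractf)
    also have "\<dots> = (\<Sum>j\<in>{..<d}-{i}. mixed_diff g i j x)"
      using False by (intro sum.cong refl) (simp add: mixed_diff_def)
    finally show ?thesis using False by (simp only: if_False)
  qed
  then show ?thesis
    unfolding mask_generator_def[of d "mask_generator d g"] mask_generator_def[of d g x]
      sum.distrib[symmetric]
    by (intro sum.cong refl) (simp flip: mask_generator_def)
qed

section \<open>Conditional mutual information\<close>

text \<open>Double counting: each state arises as x[i := c] from as many pairs (x, c) as there are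
  values.\<close>

lemma sum_states_average:
  fixes g :: "state \<Rightarrow> real"
  assumes i: "i < d"
  shows "(\<Sum>x\<in>states d S. \<Sum>c\<in>vocab S. g (x[i := c])) = real (card (vocab S)) * (\<Sum>x\<in>states d S. g x)"
  unfolding sum_states_split[OF i, of "\<lambda>x. \<Sum>c\<in>vocab S. g (x[i := c])"] sum_states_split[OF i, of g]
  by (simp add: sum_distrib_left)

lemma sum_states_average2:
  fixes g :: "state \<Rightarrow> real"
  assumes "i < d" "j < d"
  shows "(\<Sum>x\<in>states d S. \<Sum>a\<in>vocab S. \<Sum>b\<in>vocab S. g (x[i := a, j := b])) =
    real (card (vocab S))^2 * (\<Sum>x\<in>states d S. g x)"
  using sum_states_average[OF assms(1), where g = "\<lambda>x. \<Sum>b\<in>vocab S. g (x[j := b])"]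
    sum_states_average[OF assms(2), where g = g]
  by (simp add: power2_eq_square)

text \<open>Let r be the law that makes the two coordinates conditionally independent. Then q ln (q
  / r) >= q - r on the support of q, and r has at most the mass of q.\<close>

lemma cond_mi_nonneg:
  assumes i: "i < d" and j: "j < d" and ij: "i \<noteq> j"
    and q: "\<And>x. x \<in> states d S \<Longrightarrow> q x \<ge> 0"
  shows "cond_mi d S q i j \<ge> 0"
proof -
  define row where "row x = (\<Sum>b\<in>vocab S. q (x[j := b]))" for x
  define col where "col x = (\<Sum>a\<in>vocab S. q (x[i := a]))" for x
  define tot where "tot x = (\<Sum>a\<in>vocab S. \<Sum>b\<in>vocab S. q (x[i := a, j := b]))" for x
  define r where "r x = row x * col x / tot x" for x
  have nonneg: "row x \<ge> 0" "col x \<ge> 0" "tot x \<ge> 0" "r x \<ge> 0" if "x \<in> states d S" for x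
    using that q by (auto simp: row_def col_def tot_def r_def intro!: sum_nonneg divide_nonneg_nonneg mult_nonneg_nonneg)
  have "q x - r x \<le> q x * ln (q x * tot x / (row x * col x))" if x: "x \<in> states d S" "q x > 0" for x
  proof -
    have mem: "x ! i \<in> vocab S" "x ! j \<in> vocab S" using x i j by auto
    have row: "row x > 0"
      unfolding row_def using x q mem by (intro sum_pos2[of _ "x ! j"]) auto
    have col: "col x > 0"
      unfolding col_def using x q mem by (intro sum_pos2[of _ "x ! i"]) auto
    have row': "(\<Sum>b\<in>vocab S. q (x[i := x ! i, j := b])) > 0" using row by (simp add: row_def)
    have tot: "tot x > 0"
      unfolding tot_def
      by (rule sum_pos2[of _ "x ! i"]) (use x q mem row' in \<open>auto intro!: sum_nonneg\<close>)
    have "ln (row x * col x / (q x * tot x)) \<le> row x * col x / (q x * tot x) - 1"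
      using row col tot x by (intro ln_le_minus_one) simp
    moreover have "ln (q x * tot x / (row x * col x)) = - ln (row x * col x / (q x * tot x))"
      using row col tot x by (simp add: ln_div ln_mult)
    ultimately have "1 - row x * col x / (q x * tot x) \<le> ln (q x * tot x / (row x * col x))" by simp
    then have "q x * (1 - row x * col x / (q x * tot x)) \<le> q x * ln (q x * tot x / (row x * col x))"
      using x by (intro mult_left_mono) auto
    moreover have "q x * (1 - row x * col x / (q x * tot x)) = q x - r x"
      using x tot by (simp add: r_def field_simps)
    ultimately show ?thesis by simp
  qed
  then have "(\<Sum>x\<in>{x\<in>states d S. q x > 0}. q x - r x) \<le> cond_mi d S q i j"
    unfolding cond_mi_def Let_def row_def col_def tot_def by (intro sum_mono) auto
  \<comment> \<open>Off the support of q the summand is - r, so passing to all states only lowers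
    the sum.\<close>
  moreover have "(\<Sum>x\<in>states d S. q x - r x) \<le> (\<Sum>x\<in>{x\<in>states d S. q x > 0}. q x - r x)"
    unfolding sum.inter_filter[OF finite_states]
  proof (rule sum_mono)
    fix x assume x: "x \<in> states d S"
    then show "q x - r x \<le> (if q x > 0 then q x - r x else 0)"
      using q[OF x] nonneg(4)[OF x] by auto
  qed
  moreover have "0 \<le> (\<Sum>x\<in>states d S. q x - r x)"
  proof -
    \<comment> \<open>On each fiber of the coordinates i and j, row sums times column sums divided
      by the total give the total back. A zero total is covered by the convention that division by
      zero yields zero.\<close>
    have "0 \<le> (\<Sum>x\<in>states d S. \<Sum>a\<in>vocab S. \<Sum>b\<in>vocab S. q (x[i := a, j := b]) - r (x[i := a, j := b]))"
    proof (rule sum_nonneg)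
      fix x assume x: "x \<in> states d S"
      have swap: "x[i := a, j := b, i := c] = x[i := c, j := b]" for a b c
        unfolding list_update_swap[OF ij[symmetric], of "x[i := a]"] by simp
      have "tot (x[i := a, j := b]) = tot x" for a b
        by (simp add: tot_def swap)
      then have "(\<Sum>a\<in>vocab S. \<Sum>b\<in>vocab S. r (x[i := a, j := b])) =
         (\<Sum>a\<in>vocab S. \<Sum>b\<in>vocab S. (\<Sum>b'\<in>vocab S. q (x[i := a, j := b'])) *
            (\<Sum>a'\<in>vocab S. q (x[i := a', j := b]))) / tot x"
        by (simp add: r_def row_def col_def swap sum_divide_distrib)
      also have "\<dots> = (\<Sum>a\<in>vocab S. \<Sum>b'\<in>vocab S. q (x[i := a, j := b'])) *
            (\<Sum>b\<in>vocab S. \<Sum>a'\<in>vocab S. q (x[i := a', j := b])) / tot x"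
        by (simp only: sum_product)
      also have "(\<Sum>b\<in>vocab S. \<Sum>a'\<in>vocab S. q (x[i := a', j := b])) = tot x"
        unfolding tot_def by (rule sum.swap)
      also have "(\<Sum>a\<in>vocab S. \<Sum>b'\<in>vocab S. q (x[i := a, j := b'])) * tot x / tot x \<le> tot x"
        by (simp add: tot_def)
      finally show "0 \<le> (\<Sum>a\<in>vocab S. \<Sum>b\<in>vocab S. q (x[i := a, j := b]) - r (x[i := a, j := b]))"
        by (simp add: sum_subtractf tot_def)
    qed
    then show ?thesis
      unfolding sum_states_average2[OF i j, of "\<lambda>x. q x - r x"]
      by (simp add: zero_le_mult_iff vocab_def card_insert_if)
  qed
  ultimately show ?thesis by linarith
qed

section \<open>Logarithmic marginals and the effective total correlation\<close>

definition log_marginal :: "nat \<Rightarrow> nat \<Rightarrow> (state \<Rightarrow> real) \<Rightarrow> state \<Rightarrow> real" where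
  "log_marginal d S q0 x = ln (revealed_marginal d S q0 x)"

lemma coord_weight_nonneg: "t \<ge> 0 \<Longrightarrow> coord_weight t c \<ge> 0"
  by (simp add: coord_weight_def)

lemma revealed_marginal_nonneg:
  assumes "\<And>x. q0 x \<ge> 0"
  shows "revealed_marginal d S q0 x \<ge> 0"
  unfolding revealed_marginal_def using assms by (intro sum_nonneg mult_nonneg_nonneg prod_nonneg) auto

text \<open>Masking a coordinate weakens the condition on the data. Positivity at x therefore passes
  to every state obtained from x by masking.\<close>

lemma revealed_marginal_mono:
  assumes "\<And>x. q0 x \<ge> 0" and "length x = d"
  shows "revealed_marginal d S q0 x \<le> revealed_marginal d S q0 (x[i := None])"
  unfolding revealed_marginal_def
proof (intro sum_mono mult_left_mono assms prod_mono conjI)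
  fix z j assume "j \<in> {..<d}"
  then show "(if x ! j = None \<or> x ! j = z ! j then 1 else 0 :: real) \<le>
    (if x[i := None] ! j = None \<or> x[i := None] ! j = z ! j then 1 else 0)"
    using assms(2) by (cases "i = j") auto
qed auto

lemma mask_law_nonneg:
  assumes "\<And>x. q0 x \<ge> 0" and "t \<ge> 0"
  shows "mask_law d S q0 t x \<ge> 0"
  unfolding mask_law_factor using assms
  by (intro mult_nonneg_nonneg prod_nonneg revealed_marginal_nonneg) (auto simp: coord_weight_nonneg)

lemma revealed_marginal_pos:
  assumes "\<And>x. q0 x \<ge> 0" and "mask_law d S q0 t x > 0"
  shows "revealed_marginal d S q0 x > 0"
proof -
  have "revealed_marginal d S q0 x \<noteq> 0" using assms(2) unfolding mask_law_factor by auto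
  then show ?thesis using revealed_marginal_nonneg[of q0 d S x] assms(1) by (simp add: less_le)
qed

text \<open>\<open>I\<close> collects the coordinates already split off; conditional mutual
  information needs the products without one or two coordinates.\<close>

definition rest_weight :: "nat \<Rightarrow> real \<Rightarrow> nat set \<Rightarrow> state \<Rightarrow> real" where
  "rest_weight d t I x = (\<Prod>k\<in>{..<d}-I. coord_weight t (x ! k))"

lemma rest_weight_update [simp]: "i \<in> I \<Longrightarrow> rest_weight d t I (x[i := c]) = rest_weight d t I x"
  unfolding rest_weight_def by (intro prod.cong refl) (metis DiffE nth_list_update_neq)

lemma rest_weight_remove:
  assumes "i < d" "i \<notin> I"
  shows "rest_weight d t I x = coord_weight t (x ! i) * rest_weight d t (insert i I) x"
proof -
  have "{..<d} - I - {i} = {..<d} - insert i I" by auto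
  then show ?thesis unfolding rest_weight_def using assms by (subst prod.remove[of _ i]) auto
qed

lemma mask_law_rest_weight: "mask_law d S q0 t x = rest_weight d t {} x * revealed_marginal d S q0 x"
  by (simp add: mask_law_factor rest_weight_def)

text \<open>The weights 1 - exp (-t) and exp (-t) add up to one, so averaging over the value at i
  has the same effect on the marginal as masking i.\<close>

lemma coord_weight_average:
  assumes "i < d" "x \<in> states d S"
  shows "(\<Sum>c\<in>vocab S. coord_weight t c * revealed_marginal d S q0 (x[i := c])) =
    revealed_marginal d S q0 (x[i := None])"
  using revealed_marginal_sum[OF assms, of q0]
  by (simp add: sum_vocab coord_weight_def algebra_simps flip: sum_distrib_left)

lemma sum_mask_law_coord:
  assumes j: "j < d" and x: "x \<in> states d S"
  shows "(\<Sum>b\<in>vocab S. mask_law d S q0 t (x[j := b])) =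
    rest_weight d t {j} x * revealed_marginal d S q0 (x[j := None])"
proof -
  have "mask_law d S q0 t (x[j := b]) =
      rest_weight d t {j} x * (coord_weight t b * revealed_marginal d S q0 (x[j := b]))" for b
    using j x rest_weight_remove[OF j, of "{}" t "x[j := b]"] by (simp add: mask_law_rest_weight)
  then show ?thesis using coord_weight_average[OF j x, of t q0] by (simp flip: sum_distrib_left)
qed

text \<open>Summing out a coordinate of the density masks it in \<open>revealed_marginal\<close>.
  All weights then cancel in the ratio under the logarithm, and four values of the log marginal
  remain.\<close>

lemma cond_mi_mask_law:
  assumes i: "i < d" and j: "j < d" and ij: "i \<noteq> j" and q0: "\<And>x. q0 x \<ge> 0" and t: "t \<ge> 0"
  shows "cond_mi d S (mask_law d S q0 t) i j =
    mask_expect d S q0 (mixed_diff (log_marginal d S q0) i j) t"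
proof -
  let ?q = "mask_law d S q0 t" and ?m = "revealed_marginal d S q0" and ?w = "coord_weight t"
  have eq: "?q x * ln (?q x * (\<Sum>a\<in>vocab S. \<Sum>b\<in>vocab S. ?q (x[i := a, j := b])) /
      ((\<Sum>b\<in>vocab S. ?q (x[j := b])) * (\<Sum>a\<in>vocab S. ?q (x[i := a])))) =
      ?q x * mixed_diff (log_marginal d S q0) i j x"
    if x: "x \<in> states d S" and pos: "?q x > 0" for x
  proof -
    let ?R = "rest_weight d t {i, j} x"
    have swap: "x[i := a, j := b] = x[j := b, i := a]" for a b
      by (rule list_update_swap[OF ij])
    have row: "(\<Sum>b\<in>vocab S. ?q (x[j := b])) = ?w (x ! i) * ?R * ?m (x[j := None])"
      using sum_mask_law_coord[OF j x, of q0 t] rest_weight_remove[OF i, of "{j}" t x] ij by simp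
    have col: "(\<Sum>a\<in>vocab S. ?q (x[i := a])) = ?w (x ! j) * ?R * ?m (x[i := None])"
      using sum_mask_law_coord[OF i x, of q0 t] rest_weight_remove[OF j, of "{i}" t x] ij
      by (simp add: insert_commute)
    have self: "?q x = ?w (x ! i) * ?w (x ! j) * ?R * ?m x"
      using rest_weight_remove[OF i, of "{}" t x] rest_weight_remove[OF j, of "{i}" t x] ij
      by (simp add: mask_law_rest_weight insert_commute)
    have "(\<Sum>b\<in>vocab S. ?q (x[i := a, j := b])) = ?R * (?w a * ?m (x[j := None, i := a]))"
      if "a \<in> vocab S" for a
      using sum_mask_law_coord[OF j update_states[OF x that, of i], where ?q0.0 = q0 and t = t]
        rest_weight_remove[OF i, of "{j}" t "x[i := a]"] ij i x swap[of a None] by simp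
    then have tot: "(\<Sum>a\<in>vocab S. \<Sum>b\<in>vocab S. ?q (x[i := a, j := b])) = ?R * ?m (x[i := None, j := None])"
      using coord_weight_average[OF i update_states[OF x None_in_vocab, of j], of t q0] swap[of None None]
      by (simp flip: sum_distrib_left)
    have m: "?m x > 0" using revealed_marginal_pos[OF q0 pos] .
    have mi: "?m (x[i := None]) > 0" and mj: "?m (x[j := None]) > 0"
      using revealed_marginal_mono[of q0 x d S] q0 x m by (auto intro: less_le_trans)
    have mij: "?m (x[i := None, j := None]) > 0"
      using revealed_marginal_mono[of q0 "x[i := None]" d S j] q0 x mi by (auto intro: less_le_trans)
    have nz: "?w (x ! i) \<noteq> 0" "?w (x ! j) \<noteq> 0" "?R \<noteq> 0"
      using pos unfolding self by auto
    have "ln (?q x * (\<Sum>a\<in>vocab S. \<Sum>b\<in>vocab S. ?q (x[i := a, j := b])) /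
      ((\<Sum>b\<in>vocab S. ?q (x[j := b])) * (\<Sum>a\<in>vocab S. ?q (x[i := a])))) =
      ln (?m x * ?m (x[i := None, j := None]) / (?m (x[j := None]) * ?m (x[i := None])))"
      unfolding row col tot self using nz by (simp add: field_simps)
    also have "\<dots> = ln (?m (x[i := None, j := None])) - ln (?m (x[i := None])) - ln (?m (x[j := None])) + ln (?m x)"
      using m mi mj mij by (simp add: ln_mult ln_div)
    \<comment> \<open>If i or j is masked in x, the four terms cancel in pairs, in agreement with
      the zero case of \<open>mixed_diff\<close>.\<close>
    also have "\<dots> = mixed_diff (log_marginal d S q0) i j x"
      using swap[of None None] ij by (auto simp: mixed_diff_def log_marginal_def)
    finally show ?thesis by simp
  qed
  have "cond_mi d S ?q i j = (\<Sum>x\<in>{x\<in>states d S. ?q x > 0}. ?q x * mixed_diff (log_marginal d S q0) i j x)"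
    unfolding cond_mi_def Let_def by (intro sum.cong refl) (simp add: eq)
  also have "\<dots> = mask_expect d S q0 (mixed_diff (log_marginal d S q0) i j) t"
    unfolding mask_expect_def
  proof (rule sum.mono_neutral_left)
    show "\<forall>x\<in>states d S - {x \<in> states d S. ?q x > 0}. ?q x * mixed_diff (log_marginal d S q0) i j x = 0"
    proof
      fix x assume "x \<in> states d S - {x \<in> states d S. ?q x > 0}"
      then have "?q x = 0" using mask_law_nonneg[of q0 t d S x] q0 t by (auto simp: not_less)
      then show "?q x * mixed_diff (log_marginal d S q0) i j x = 0" by simp
    qed
  qed auto
  finally show ?thesis .
qed

lemma eff_tc_nonneg:
  assumes "\<And>x. q0 x \<ge> 0" "t \<ge> 0"
  shows "eff_tc d S q0 t \<ge> 0"
  unfolding eff_tc_def using assms by (intro sum_nonneg cond_mi_nonneg mask_law_nonneg) auto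

text \<open>By \<open>mask_expect_has_derivative\<close> the two terms are the second and the first
  time derivative of the expected log marginal.\<close>

lemma eff_tc_eq:
  fixes d S :: nat
  assumes q0: "\<And>x. q0 x \<ge> 0" and t: "t \<ge> 0"
  defines "L \<equiv> log_marginal d S q0"
  shows "eff_tc d S q0 t =
    mask_expect d S q0 (mask_generator d (mask_generator d L)) t + mask_expect d S q0 (mask_generator d L) t"
proof -
  have "eff_tc d S q0 t = (\<Sum>i<d. \<Sum>j\<in>{..<d}-{i}. \<Sum>x\<in>states d S. mask_law d S q0 t x * mixed_diff L i j x)"
    unfolding eff_tc_def L_def using q0 t
    by (intro sum.cong refl) (simp add: cond_mi_mask_law mask_expect_def)
  also have "\<dots> = (\<Sum>i<d. \<Sum>x\<in>states d S. \<Sum>j\<in>{..<d}-{i}. mask_law d S q0 t x * mixed_diff L i j x)"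
    by (intro sum.cong refl sum.swap)
  also have "\<dots> = (\<Sum>x\<in>states d S. \<Sum>i<d. \<Sum>j\<in>{..<d}-{i}. mask_law d S q0 t x * mixed_diff L i j x)"
    by (rule sum.swap)
  also have "\<dots> = (\<Sum>x\<in>states d S. mask_law d S q0 t x *
      (mask_generator d (mask_generator d L) x + mask_generator d L x))"
    by (intro sum.cong refl) (simp add: mask_generator_twice sum_distrib_left)
  finally show ?thesis by (simp add: mask_expect_def distrib_left sum.distrib)
qed

lemma linearization_gap_le:
  fixes d S :: nat
  assumes q0: "\<And>x. q0 x \<ge> 0" and u: "u \<ge> 0" and h: "h \<ge> 0"
  defines "L \<equiv> log_marginal d S q0"
  shows "mask_expect d S q0 L u - mask_expect d S q0 L (u + h) +
      (exp h - 1) * mask_expect d S q0 (mask_generator d L) (u + h)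
    \<le> (exp h - 1) * integral {u..u + h} (eff_tc d S q0)"
proof -
  let ?G = "mask_expect d S q0 L" and ?G' = "mask_expect d S q0 (mask_generator d L)"
    and ?G'' = "mask_expect d S q0 (mask_generator d (mask_generator d L))"
  \<comment> \<open>\<open>\<Psi>\<close> vanishes at u and equals the gap at u + h. Differentiating
    the factor exp (v - u) turns - G' into (exp (v - u) - 1) G', which matches the coefficient of
    G''.\<close>
  define \<Psi> where "\<Psi> v = ?G u - ?G v + (exp (v - u) - 1) * ?G' v" for v
  define e where "e v = ?G'' v + ?G' v" for v
  have e: "eff_tc d S q0 v = e v" if "v \<ge> 0" for v
    unfolding e_def L_def by (rule eff_tc_eq[OF q0 that])
  have deriv: "(\<Psi> has_vector_derivative (exp (v - u) - 1) * e v) (at v within {u..u + h})" for v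
  proof -
    have "(\<Psi> has_real_derivative (0 - ?G' v) + ((exp (v - u) * 1) * ?G' v + (exp (v - u) - 1) * ?G'' v)) (at v)"
      unfolding \<Psi>_def
      by (auto intro!: derivative_eq_intros mask_expect_has_derivative)
    then have "(\<Psi> has_real_derivative (exp (v - u) - 1) * e v) (at v)"
      by (rule DERIV_cong) (simp add: e_def algebra_simps)
    then show ?thesis
      by (simp add: has_real_derivative_iff_has_vector_derivative has_vector_derivative_at_within)
  qed
  have I: "((\<lambda>v. (exp (v - u) - 1) * e v) has_integral \<Psi> (u + h) - \<Psi> u) {u..u + h}"
    using h deriv by (intro fundamental_theorem_of_calculus) auto
  have "continuous_on {u..u + h} e"
    unfolding e_def
    by (intro continuous_on_add
        DERIV_continuous_on[OF has_field_derivative_at_within[OF mask_expect_has_derivative]])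
  then have J: "((\<lambda>v. (exp h - 1) * e v) has_integral (exp h - 1) * integral {u..u + h} e) {u..u + h}"
    by (intro has_integral_mult_right integrable_integral integrable_continuous_real)
  have "\<Psi> (u + h) - \<Psi> u \<le> (exp h - 1) * integral {u..u + h} e"
  proof (rule has_integral_le[OF I J])
    fix v assume v: "v \<in> {u..u + h}"
    then have "e v \<ge> 0" using e[of v] eff_tc_nonneg[of q0 v d S] q0 u by auto
    then show "(exp (v - u) - 1) * e v \<le> (exp h - 1) * e v"
      using v by (intro mult_right_mono) auto
  qed
  moreover have "integral {u..u + h} e = integral {u..u + h} (eff_tc d S q0)"
    using u by (intro integral_cong) (simp add: e)
  ultimately show ?thesis by (simp add: \<Psi>_def)
qed

section \<open>Initialization and score entropy\<close>

text \<open>Both laws carry the same weights, so their ratio is a marginal, which is at most 1,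
  times S to the number of unmasked coordinates. Each coordinate is unmasked at time T with
  probability exp (-T).\<close>

lemma KL_init_law_le:
  assumes q0: "\<And>x. q0 x \<ge> 0" "(\<Sum>x\<in>data_states d S. q0 x) = 1" and S: "S \<ge> 1" and T: "T > 0"
  shows "(\<Sum>x\<in>states d S. mask_law d S q0 T x * ln (mask_law d S q0 T x / init_law d S T x))
    \<le> exp (- T) * real d * ln (real S)"
proof -
  let ?q = "mask_law d S q0 T" and ?m = "revealed_marginal d S q0"
  define \<sigma> where "\<sigma> c = (if c = None then 1 else real S)" for c :: "nat option"
  have "?q x * ln (?q x / init_law d S T x) \<le> (\<Sum>i<d. ln (\<sigma> (x ! i)) * ?q x)" if x: "x \<in> states d S" for x
  proof (cases "?q x > 0")
    case False
    then have "?q x = 0" using mask_law_nonneg[of q0 T d S x] q0 T by simp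
    then show ?thesis by simp
  next
    case True
    have init: "init_law d S T x = (\<Prod>i<d. coord_weight T (x ! i)) / (\<Prod>i<d. \<sigma> (x ! i))"
      unfolding init_law_def prod_dividef[symmetric]
    proof (intro prod.cong refl)
      fix i assume "i \<in> {..<d}"
      then have "x ! i \<in> vocab S" using x by simp
      then show "(if x ! i = None then 1 - exp (- T) else if x ! i \<in> Some ` {1..S} then exp (- T) / real S else 0) =
        coord_weight T (x ! i) / \<sigma> (x ! i)"
        by (auto simp: vocab_def coord_weight_def \<sigma>_def)
    qed
    have \<sigma>: "(\<Prod>i<d. \<sigma> (x ! i)) > 0" using S by (intro prod_pos) (auto simp: \<sigma>_def)
    have m: "?m x > 0" using revealed_marginal_pos[OF q0(1) True] .
    have "?m x \<le> (\<Sum>z\<in>data_states d S. q0 z * 1)"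
      unfolding revealed_marginal_def using q0 by (intro sum_mono mult_left_mono prod_le_1) auto
    then have m1: "?m x \<le> 1" using q0 by simp
    have "(\<Prod>i<d. coord_weight T (x ! i)) \<noteq> 0"
      using True unfolding mask_law_factor by (metis less_irrefl mult_zero_left)
    moreover have "W * m / (W / s) = m * s" if "W \<noteq> 0" for W m s :: real
      using that by simp
    ultimately have "?q x / init_law d S T x = ?m x * (\<Prod>i<d. \<sigma> (x ! i))"
      unfolding init mask_law_factor by blast
    moreover have "ln (?m x * (\<Prod>i<d. \<sigma> (x ! i))) \<le> ln (\<Prod>i<d. \<sigma> (x ! i))"
      using m m1 \<sigma> by (simp add: mult_le_cancel_right1)
    moreover have "ln (\<Prod>i<d. \<sigma> (x ! i)) = (\<Sum>i<d. ln (\<sigma> (x ! i)))"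
      using S by (intro ln_prod) (auto simp: \<sigma>_def)
    ultimately have "ln (?q x / init_law d S T x) \<le> (\<Sum>i<d. ln (\<sigma> (x ! i)))" by simp
    then have "?q x * ln (?q x / init_law d S T x) \<le> ?q x * (\<Sum>i<d. ln (\<sigma> (x ! i)))"
      using True by (intro mult_left_mono) auto
    then show ?thesis by (simp add: sum_distrib_left mult.commute)
  qed
  then have "(\<Sum>x\<in>states d S. ?q x * ln (?q x / init_law d S T x)) \<le>
     (\<Sum>x\<in>states d S. \<Sum>i<d. ln (\<sigma> (x ! i)) * ?q x)"
    by (rule sum_mono)
  also have "\<dots> = (\<Sum>i<d. \<Sum>x\<in>states d S. ln (\<sigma> (x ! i)) * ?q x)" by (rule sum.swap)
  also have "\<dots> = (\<Sum>i<d. exp (- T) * ln (real S))"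
  proof (rule sum.cong[OF refl])
    fix i assume "i \<in> {..<d}"
    then have i: "i < d" by simp
    have "(\<Sum>x\<in>states d S. ln (\<sigma> (x ! i)) * ?q x) =
      (\<Sum>z\<in>data_states d S. q0 z * (\<Sum>x\<in>states d S. ln (\<sigma> (x ! i)) * (\<Prod>j<d. coord_law T (z ! j) (x ! j))))"
      unfolding mask_law_eq sum_distrib_left by (subst sum.swap) (simp add: mult.left_commute)
    also have "\<dots> = (\<Sum>z\<in>data_states d S. q0 z * (exp (- T) * ln (real S)))"
    proof (intro sum.cong refl arg_cong2[where f = "(*)"])
      fix z assume z: "z \<in> data_states d S"
      have zj: "z ! j \<in> Some ` {1..S}" if "j < d" for j
        using z that by (auto elim: nth_data_states)
      have "(\<Prod>j\<in>{..<d}-{i}. \<Sum>c\<in>vocab S. coord_law T (z ! j) c) = 1"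
        using zj by (intro prod.neutral) (auto simp: sum_coord_law)
      moreover have "(\<Sum>c\<in>vocab S. ln (\<sigma> c) * coord_law T (z ! i) c) = exp (- T) * ln (real S)"
        using zj[OF i] unfolding sum_vocab sum_coord_law_Some[OF zj[OF i], of "\<lambda>c. ln (\<sigma> c)"]
        by (auto simp: \<sigma>_def)
      ultimately show "(\<Sum>x\<in>states d S. ln (\<sigma> (x ! i)) * (\<Prod>j<d. coord_law T (z ! j) (x ! j))) =
        exp (- T) * ln (real S)"
        using sum_states_prod_coord[OF i, of "\<lambda>c. ln (\<sigma> c)" "\<lambda>j. coord_law T (z ! j)" S] by simp
    qed
    also have "\<dots> = exp (- T) * ln (real S)" using q0(2) by (simp flip: sum_distrib_right)
    finally show "(\<Sum>x\<in>states d S. ln (\<sigma> (x ! i)) * ?q x) = exp (- T) * ln (real S)" .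
  qed
  finally show ?thesis by (simp add: mult_ac)
qed

section \<open>Error of one masked coordinate\<close>

text \<open>The first alternative is \<open>bernoulli_KL_le\<close> at \<delta> = - ln (1 - \<rho>).
  In the second, which is the last step, the left side is zero and ln r <= r - 1 remains.\<close>

lemma stay_KL_le:
  fixes \<rho> r P :: real
  assumes r: "r > 0"
    and P: "0 < \<rho> \<and> \<rho> < 1 \<and> P = exp (r * ln (1 - \<rho>)) \<or> \<rho> = 1 \<and> P = 0"
  shows "(1 - \<rho>) * ln ((1 - \<rho>) / P) + \<rho> * ln (\<rho> / (1 - P)) \<le> \<rho> * (r - 1 - ln r)"
  using P
proof
  assume A: "0 < \<rho> \<and> \<rho> < 1 \<and> P = exp (r * ln (1 - \<rho>))"
  define \<delta> where "\<delta> = - ln (1 - \<rho>)"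
  have \<delta>: "\<delta> > 0" using A by (simp add: \<delta>_def)
  have \<rho>: "1 - \<rho> = exp (- \<delta>)" "\<rho> = 1 - exp (- \<delta>)" using A by (simp_all add: \<delta>_def)
  have Pe: "P = exp (- (r * \<delta>))" using A by (simp add: \<delta>_def)
  have "ln ((1 - \<rho>) / P) = \<delta> * (r - 1)"
    unfolding \<rho>(1) Pe by (simp add: exp_diff[symmetric] algebra_simps)
  then show ?thesis using bernoulli_KL_le[OF \<delta> r] unfolding Pe \<rho>(2)[symmetric] \<rho>(1)[symmetric]
    by (simp add: mult.assoc)
next
  assume "\<rho> = 1 \<and> P = 0"
  then show ?thesis using ln_le_minus_one[OF r] by simp
qed

text \<open>The error splits into staying versus leaving, bounded by \<open>stay_KL_le\<close>, and
  the choice of the symbol. The left side uses \<rho> instead of the probability \<rho> s_a / \<mu>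
  of the symbol a; the missing logarithm of s_a / \<mu> is the subtracted term on the right.\<close>

lemma coordinate_error_le:
  fixes s shat :: "'a \<Rightarrow> real"
  assumes A: "finite A" "A \<noteq> {}" and s: "\<And>a. a \<in> A \<Longrightarrow> s a \<ge> 0" and shat: "\<And>a. a \<in> A \<Longrightarrow> shat a > 0"
    and \<mu>: "sum s A = \<mu>" "\<mu> > 0" and e: "e > 0"
  defines "\<Lambda> \<equiv> sum shat A" and "\<rho> \<equiv> e * \<mu>"
  assumes P: "0 < \<rho> \<and> \<rho> < 1 \<and> P = exp (\<Lambda> / \<mu> * ln (1 - \<rho>)) \<or> \<rho> = 1 \<and> P = 0"
  shows "(1 - \<rho>) * ln ((1 - \<rho>) / P) + e * (\<Sum>a\<in>A. s a * ln (\<rho> / ((1 - P) * shat a / \<Lambda>)))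
    \<le> e * (\<Sum>a\<in>A. weighted_D (shat a) (s a)) - e * (\<Sum>a\<in>A. s a * ln (s a / \<mu>))"
proof -
  have \<Lambda>: "\<Lambda> > 0" unfolding \<Lambda>_def using A shat by (intro sum_pos) auto
  have \<rho>: "\<rho> > 0" using \<mu> e by (simp add: \<rho>_def)
  have P1: "1 - P > 0" using P
  proof
    assume "0 < \<rho> \<and> \<rho> < 1 \<and> P = exp (\<Lambda> / \<mu> * ln (1 - \<rho>))"
    then show ?thesis using \<Lambda> \<mu> by (simp add: mult_pos_neg divide_neg_pos)
  qed simp
  \<comment> \<open>\<open>c\<close> gathers the logarithms that do not depend on the symbol, so
    that each symbol leaves only shat - s - s c.\<close>
  define c where "c = ln (\<rho> / (1 - P)) + ln (\<Lambda> / \<mu>)"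
  have "weighted_D (shat a) (s a) - s a * ln (s a / \<mu>) - s a * ln (\<rho> / ((1 - P) * shat a / \<Lambda>))
     = shat a - s a - s a * c" if a: "a \<in> A" for a
  proof (cases "s a = 0")
    case False
    then have sa: "s a > 0" "shat a > 0" using s shat a by (auto simp: less_le)
    have e1: "ln (\<rho> / ((1 - P) * shat a / \<Lambda>)) = ln (\<rho> / (1 - P)) + ln \<Lambda> - ln (shat a)"
      using \<rho> P1 sa \<Lambda> by (simp add: ln_div ln_mult)
    have e2: "ln (\<Lambda> / \<mu>) = ln \<Lambda> - ln \<mu>" "ln (s a / \<mu>) = ln (s a) - ln \<mu>"
      "ln (shat a / s a) = ln (shat a) - ln (s a)"
      using \<Lambda> \<mu> sa by (simp_all add: ln_div)
    have e3: "weighted_D (shat a) (s a) = shat a - s a - s a * ln (shat a / s a)"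
      using sa by (simp add: weighted_D_def Dfun_def right_diff_distrib)
    show ?thesis unfolding c_def e1 e2 e3 by (simp add: algebra_simps)
  qed (simp add: weighted_D_def)
  then have "(\<Sum>a\<in>A. weighted_D (shat a) (s a) - s a * ln (s a / \<mu>) - s a * ln (\<rho> / ((1 - P) * shat a / \<Lambda>)))
     = (\<Sum>a\<in>A. shat a - s a - s a * c)"
    by (rule sum.cong[OF refl])
  then have "(\<Sum>a\<in>A. weighted_D (shat a) (s a)) - (\<Sum>a\<in>A. s a * ln (s a / \<mu>)) -
      (\<Sum>a\<in>A. s a * ln (\<rho> / ((1 - P) * shat a / \<Lambda>))) = \<Lambda> - \<mu> - \<mu> * c"
    by (simp add: sum_subtractf \<Lambda>_def \<mu>(1) flip: sum_distrib_right)
  then have "e * (\<Sum>a\<in>A. weighted_D (shat a) (s a)) - e * (\<Sum>a\<in>A. s a * ln (s a / \<mu>)) -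
      e * (\<Sum>a\<in>A. s a * ln (\<rho> / ((1 - P) * shat a / \<Lambda>))) = e * (\<Lambda> - \<mu> - \<mu> * c)"
    by (simp only: right_diff_distrib[symmetric])
  moreover have "e * (\<Lambda> - \<mu> - \<mu> * c) = \<rho> * (\<Lambda> / \<mu> - 1 - ln (\<Lambda> / \<mu>)) - \<rho> * ln (\<rho> / (1 - P))"
    using \<mu> by (simp add: \<rho>_def c_def field_simps)
  moreover have "(1 - \<rho>) * ln ((1 - \<rho>) / P) + \<rho> * ln (\<rho> / (1 - P)) \<le> \<rho> * (\<Lambda> / \<mu> - 1 - ln (\<Lambda> / \<mu>))"
    using \<Lambda> \<mu> P by (intro stay_KL_le) auto
  ultimately show ?thesis by linarith
qed

section \<open>Score entropy as a sum over masked coordinates\<close>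

text \<open>The states that can jump into x arise from x by revealing one masked coordinate, and the
  position and the symbol can be read off from the result.\<close>

lemma sum_mask_rate:
  assumes x: "x \<in> states d S"
  shows "(\<Sum>y\<in>states d S - {x}. mask_rate d y x * F y) =
    (\<Sum>i\<in>{i. i < d \<and> x ! i = None}. \<Sum>a\<in>{1..S}. F (x[i := Some a]))"
proof -
  let ?I = "{i. i < d \<and> x ! i = None} \<times> {1..S}" and ?f = "\<lambda>(i, a). x[i := Some a]"
  have inj: "inj_on ?f ?I"
  proof (rule inj_onI, clarify)
    fix i a j b assume *: "i < d" "x ! i = None" "j < d" "x ! j = None" "x[i := Some a] = x[j := Some b]"
    have "x[j := Some b] ! i = Some a" using * x by (metis length_states nth_list_update_eq)
    then have "i = j" using * by (metis nth_list_update_neq option.distinct(1))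
    then show "i = j \<and> a = b" using \<open>x[j := Some b] ! i = Some a\<close> * x by simp
  qed
  have img: "{y \<in> states d S - {x}. \<exists>i<d. y ! i \<noteq> None \<and> x = y[i := None]} = ?f ` ?I"
  proof (intro equalityI subsetI)
    fix y assume "y \<in> {y \<in> states d S - {x}. \<exists>i<d. y ! i \<noteq> None \<and> x = y[i := None]}"
    then obtain i where y: "y \<in> states d S" "i < d" "y ! i \<noteq> None" "x = y[i := None]" by blast
    then obtain a where a: "y ! i = Some a" by blast
    have "a \<in> {1..S}" using nth_states[OF y(1,2)] a by simp
    moreover have "y = x[i := Some a]" using y a by (metis list_update_id list_update_overwrite)
    moreover have "x ! i = None" using y by simp
    ultimately show "y \<in> ?f ` ?I" using y(2) by (intro image_eqI[of _ _ "(i, a)"]) auto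
  next
    fix y assume "y \<in> ?f ` ?I"
    then obtain i a where y: "i < d" "x ! i = None" "a \<in> {1..S}" "y = x[i := Some a]" by auto
    have yi: "y ! i = Some a" using y x by simp
    moreover have "y \<noteq> x" using yi y(2) by auto
    moreover have "x = y[i := None]" using y by simp
    moreover have "y \<in> states d S" using y x by simp
    ultimately show "y \<in> {y \<in> states d S - {x}. \<exists>i<d. y ! i \<noteq> None \<and> x = y[i := None]}"
      using y(1) by blast
  qed
  have eq: "mask_rate d y x * F y = (if \<exists>i<d. y ! i \<noteq> None \<and> x = y[i := None] then F y else 0)" for y
    unfolding mask_rate_def
    by (cases "\<exists>i<d. y ! i \<noteq> None \<and> x = y[i := None]")
       (simp_all only: if_True if_False mult_1_left mult_zero_left)
  have "(\<Sum>y\<in>states d S - {x}. mask_rate d y x * F y) =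
      (\<Sum>y\<in>{y \<in> states d S - {x}. \<exists>i<d. y ! i \<noteq> None \<and> x = y[i := None]}. F y)"
    unfolding eq by (rule sum.inter_filter[symmetric]) simp
  also have "\<dots> = (\<Sum>(i, a)\<in>?I. F (x[i := Some a]))"
    unfolding img sum.reindex[OF inj] by (simp add: case_prod_unfold)
  finally show ?thesis by (simp add: sum.cartesian_product)
qed

lemma L_SE_eq:
  assumes q0: "\<And>x. q0 x \<ge> 0" and t: "t \<ge> 0"
  shows "L_SE d S q0 t shat = (\<Sum>i<d. \<Sum>x\<in>{x\<in>states d S. x ! i = None}. mask_law d S q0 t x *
    (\<Sum>a\<in>{1..S}. weighted_D (shat (x[i := Some a]) x) (score d S q0 t (x[i := Some a]) x)))"
proof -
  let ?q = "mask_law d S q0 t"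
  define W where "W i x = (\<Sum>a\<in>{1..S}. weighted_D (shat (x[i := Some a]) x) (score d S q0 t (x[i := Some a]) x))"
    for i and x :: state
  have "L_SE d S q0 t shat = (\<Sum>x\<in>{x\<in>states d S. ?q x > 0}. ?q x * (\<Sum>i\<in>{i. i < d \<and> x ! i = None}. W i x))"
    unfolding L_SE_def W_def by (intro sum.cong refl) (simp add: sum_mask_rate)
  also have "\<dots> = (\<Sum>x\<in>states d S. ?q x * (\<Sum>i\<in>{i. i < d \<and> x ! i = None}. W i x))"
  proof (rule sum.mono_neutral_left)
    show "\<forall>x\<in>states d S - {x \<in> states d S. ?q x > 0}. ?q x * (\<Sum>i\<in>{i. i < d \<and> x ! i = None}. W i x) = 0"
    proof
      fix x assume "x \<in> states d S - {x \<in> states d S. ?q x > 0}"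
      then have "?q x = 0" using mask_law_nonneg[of q0 t d S x] q0 t by (auto simp: not_less)
      then show "?q x * (\<Sum>i\<in>{i. i < d \<and> x ! i = None}. W i x) = 0" by simp
    qed
  qed auto
  also have "\<dots> = (\<Sum>x\<in>states d S. \<Sum>i<d. if x ! i = None then ?q x * W i x else 0)"
  proof (rule sum.cong[OF refl])
    fix x :: state
    have *: "{i. i < d \<and> x ! i = None} = {i\<in>{..<d}. x ! i = None}" by auto
    show "?q x * (\<Sum>i\<in>{i. i < d \<and> x ! i = None}. W i x) =
      (\<Sum>i<d. if x ! i = None then ?q x * W i x else 0)"
      unfolding * sum_distrib_left by (rule sum.inter_filter) simp
  qed
  also have "\<dots> = (\<Sum>i<d. \<Sum>x\<in>{x\<in>states d S. x ! i = None}. ?q x * W i x)"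
    unfolding sum_masked_filter by (rule sum.swap)
  finally show ?thesis by (simp only: W_def)
qed

lemma weighted_D_nonneg:
  assumes "a > 0" "s \<ge> 0"
  shows "weighted_D a s \<ge> 0"
proof (cases "s = 0")
  case False
  then have "a / s > 0" using assms by simp
  then have "Dfun a s \<ge> 0" using ln_le_minus_one[of "a / s"] by (simp add: Dfun_def)
  then show ?thesis using assms False by (simp add: weighted_D_def)
qed (use assms in \<open>simp add: weighted_D_def\<close>)

lemma L_SE_nonneg:
  assumes q0: "\<And>x. q0 x \<ge> 0" and t: "t \<ge> 0"
    and shat: "\<And>x y. x \<in> states d S \<Longrightarrow> y \<in> states d S \<Longrightarrow> shat y x > 0"
  shows "L_SE d S q0 t shat \<ge> 0"
  unfolding L_SE_eq[OF q0 t]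
  using q0 t shat
  by (intro sum_nonneg mult_nonneg_nonneg weighted_D_nonneg mask_law_nonneg)
     (auto simp: score_def mask_law_nonneg)

section \<open>Error of one step\<close>

lemma coord_trans_nonneg:
  assumes x: "x \<in> states d S"
    and shat: "\<And>x y. x \<in> states d S \<Longrightarrow> y \<in> states d S \<Longrightarrow> shat k y x > 0"
    and stay: "stay_prob S T t N shat k x i \<in> {0..1}"
  shows "coord_trans S T t N shat k x i c \<ge> 0"
proof -
  have "shat k (x[i := Some a]) x > 0" if "a \<in> {1..S}" for a
    using x that by (intro shat) auto
  then have nn: "shat k (x[i := Some a]) x \<ge> 0" if "a \<in> {1..S}" for a
    using that less_imp_le by blast
  then have "Lam S shat k x i \<ge> 0"
    unfolding Lam_def by (rule sum_nonneg)
  with nn show ?thesis using stay by (auto simp: coord_trans_def split: option.split)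
qed

lemma remask_pos_iff: "h > 0 \<Longrightarrow> remask h b c > 0 \<longleftrightarrow> c = None \<or> c = b"
  by (auto simp: remask_def coord_law_def)

lemma joint_law_nonneg:
  assumes "\<And>x. q0 x \<ge> 0" "u \<ge> 0" "h > 0"
  shows "joint_law d S q0 u h y x \<ge> 0"
  unfolding joint_law_def using assms
  by (intro mult_nonneg_nonneg prod_nonneg mask_law_nonneg) (auto simp: remask_def coord_law_def)

text \<open>What a possible transition entails. The last conclusion holds because at u = 0 the mask
  has weight 1 - exp 0 = 0.\<close>

lemma joint_law_posD:
  assumes q0: "\<And>x. q0 x \<ge> 0" and u: "u \<ge> 0" and h: "h > 0" and pos: "joint_law d S q0 u h y x > 0"
  shows "mask_law d S q0 u y > 0" and "\<And>i. i < d \<Longrightarrow> x ! i = None \<or> x ! i = y ! i"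
    and "\<And>i. i < d \<Longrightarrow> y ! i = None \<Longrightarrow> u > 0"
proof -
  have nonneg: "remask h b c \<ge> 0" for b c using h by (auto simp: remask_def coord_law_def)
  have q: "mask_law d S q0 u y \<ge> 0" using mask_law_nonneg[of q0 u d S y] q0 u by simp
  have P: "(\<Prod>i<d. remask h (y ! i) (x ! i)) \<ge> 0" by (intro prod_nonneg) (simp add: nonneg)
  show qpos: "mask_law d S q0 u y > 0"
    using pos q P unfolding joint_law_def by (simp add: zero_less_mult_iff)
  have "(\<Prod>i<d. remask h (y ! i) (x ! i)) \<noteq> 0"
    using pos unfolding joint_law_def by (metis less_irrefl mult_zero_right)
  then have "remask h (y ! i) (x ! i) > 0" if "i < d" for i
    using nonneg[of "y ! i" "x ! i"] that by (simp add: less_le)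
  then show "x ! i = None \<or> x ! i = y ! i" if "i < d" for i
    using that remask_pos_iff[OF h] by blast
  have "(\<Prod>i<d. coord_weight u (y ! i)) \<noteq> 0"
    using qpos unfolding mask_law_factor by (metis less_irrefl mult_zero_left)
  then have "coord_weight u (y ! i) \<noteq> 0" if "i < d" for i
    using that by simp
  then show "u > 0" if "i < d" "y ! i = None" for i
    using that u by (force simp: coord_weight_def)
qed

text \<open>With \<open>s = u + h\<close>, a coordinate masked at time \<open>s\<close> is unmasked by time \<open>u\<close> of the reversed
  process with probability \<open>\<rho> = (e\<^sup>h - 1) / (e\<^sup>s - 1)\<close>; the step of the algorithm is compared with this value.\<close>

lemma tau_leaping_step_error:
  fixes d S :: nat
  assumes q0: "\<And>x. q0 x \<ge> 0" and S: "S \<ge> 1" and u: "u \<ge> 0" and h: "h > 0"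
    and shat: "\<And>x y. x \<in> states d S \<Longrightarrow> y \<in> states d S \<Longrightarrow> shat k y x > 0"
    and stay: "\<And>x i. stay_prob S T t N shat k x i =
      (if u > 0 then exp (Lam S shat k x i * (exp (u + h) - 1) * ln (1 - (exp h - 1) / (exp (u + h) - 1))) else 0)"
  shows
    "\<And>x y. x \<in> states d S \<Longrightarrow> y \<in> states d S \<Longrightarrow> (\<Prod>i<d. coord_trans S T t N shat k x i (y ! i)) \<ge> 0"
    "\<And>x y. x \<in> states d S \<Longrightarrow> y \<in> states d S \<Longrightarrow> joint_law d S q0 u h y x > 0 \<Longrightarrow>
       (\<Prod>i<d. coord_trans S T t N shat k x i (y ! i)) > 0"
    "(\<Sum>y\<in>states d S. \<Sum>x\<in>states d S. joint_law d S q0 u h y x *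
        ln (joint_law d S q0 u h y x / (mask_law d S q0 (u + h) x * (\<Prod>i<d. coord_trans S T t N shat k x i (y ! i)))))
      \<le> (exp h - 1) * (L_SE d S q0 (u + h) (shat k) + integral {u..u + h} (eff_tc d S q0))"
proof -
  let ?q = "mask_law d S q0" and ?m = "revealed_marginal d S q0" and ?\<pi> = "joint_law d S q0 u h"
    and ?K = "coord_trans S T t N shat k" and ?P = "stay_prob S T t N shat k"
    and ?\<Lambda> = "Lam S shat k" and ?e = "exp h - 1" and ?f = "log_marginal d S q0"
  define s where "s = u + h"
  \<comment> \<open>The sum of the true scores over the symbols of a masked coordinate
    (\<open>total\<close> below); dividing \<open>Lam\<close> by it gives the rate ratio r of
    \<open>bernoulli_KL_le\<close>.\<close>
  define \<mu> where "\<mu> = 1 / (exp s - 1)"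
  define \<rho> where "\<rho> = ?e * \<mu>"
  have s: "s > 0" using u h by (simp add: s_def)
  have \<mu>: "\<mu> > 0" using s by (simp add: \<mu>_def)
  have e: "?e > 0" using h by simp
  have \<rho>0: "\<rho> > 0" using \<mu> e by (simp add: \<rho>_def)
  \<comment> \<open>The conditional probability of staying masked, in the form in which it occurs in
    \<open>sum_masked_joint_law\<close>.\<close>
  have \<rho>1: "1 - \<rho> = (1 - exp (- u)) / (1 - exp (- s))"
  proof -
    have "1 - \<rho> = (exp s - exp h) / (exp s - 1)"
      using s by (simp add: \<rho>_def \<mu>_def field_simps)
    also have "exp s - exp h = exp s * (1 - exp (- u))"
      by (simp add: s_def right_diff_distrib exp_add[symmetric])
    also have "exp s - 1 = exp s * (1 - exp (- s))"
      by (simp add: right_diff_distrib exp_add[symmetric])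
    finally show ?thesis by simp
  qed
  have \<rho>2: "\<rho> = exp (- u) * (1 - exp (- h)) / (1 - exp (- s))"
  proof -
    have "exp s - 1 = exp s * (1 - exp (- s))"
      by (simp add: right_diff_distrib exp_add[symmetric])
    moreover have "?e = exp s * (exp (- u) * (1 - exp (- h)))"
      by (simp add: s_def right_diff_distrib mult.assoc[symmetric] exp_add[symmetric])
    ultimately show ?thesis by (simp add: \<rho>_def \<mu>_def)
  qed
  have \<rho>u: "u > 0 \<Longrightarrow> \<rho> < 1" "u = 0 \<Longrightarrow> \<rho> = 1"
  proof -
    assume "u > 0"
    then have "1 - \<rho> > 0" unfolding \<rho>1 using s by simp
    then show "\<rho> < 1" by simp
  next
    assume "u = 0"
    then show "\<rho> = 1" using \<rho>1 by simp
  qed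
  have shat_pos: "shat k (x[i := Some a]) x > 0" if "x \<in> states d S" "a \<in> {1..S}" for x i a
    using that by (intro shat) auto
  have \<Lambda>: "?\<Lambda> x i > 0" if "x \<in> states d S" for x i
    unfolding Lam_def using that S by (intro sum_pos shat_pos) auto
  \<comment> \<open>The two alternatives of \<open>coordinate_error_le\<close>: u > 0 is a regular
    step, u = 0 the last one, where every coordinate is unmasked.\<close>
  have P: "0 < \<rho> \<and> \<rho> < 1 \<and> ?P x i = exp (?\<Lambda> x i / \<mu> * ln (1 - \<rho>)) \<or> \<rho> = 1 \<and> ?P x i = 0" for x i
    using stay[of x i] \<rho>0 \<rho>u u by (cases "u > 0") (auto simp: \<mu>_def \<rho>_def s_def)
  have P01: "0 \<le> ?P x i" "?P x i < 1" if x: "x \<in> states d S" for x i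
  proof -
    show "0 \<le> ?P x i" using P[of x i] by auto
    have "?\<Lambda> x i / \<mu> > 0" using \<Lambda>[OF x, of i] \<mu> by simp
    moreover have "\<rho> < 1 \<Longrightarrow> ln (1 - \<rho>) < 0" using \<rho>0 by simp
    ultimately show "?P x i < 1" using P[of x i] mult_pos_neg[of "?\<Lambda> x i / \<mu>" "ln (1 - \<rho>)"]
      by (auto simp del: times_divide_eq_left)
  qed
  have Knn: "?K x i c \<ge> 0" if "x \<in> states d S" for x i c
    by (rule coord_trans_nonneg[of x d S shat k T t N i c]) (use that shat P01[OF that, of i] in auto)
  then show "(\<Prod>i<d. ?K x i (y ! i)) \<ge> 0" if "x \<in> states d S" for x y
    using that by (intro prod_nonneg) auto
  have K_None: "?K x i None = ?P x i" if "x ! i = None" for x i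
    using that by (simp add: coord_trans_def)
  have K_Some: "?K x i (Some a) = (1 - ?P x i) * shat k (x[i := Some a]) x / ?\<Lambda> x i"
    if "x ! i = None" "a \<in> {1..S}" for x i a
    using that by (simp add: coord_trans_def)
  have Kpos: "?K x i (y ! i) > 0"
    if x: "x \<in> states d S" and y: "y \<in> states d S" and pos: "?\<pi> y x > 0" and i: "i < d" for x y i
  proof (cases "x ! i")
    case None
    show ?thesis
    proof (cases "y ! i")
      case None': None
      then have "u > 0" using joint_law_posD(3)[of q0, OF q0 u h pos i] by simp
      then show ?thesis using K_None[OF None] None' stay[of x i] by simp
    next
      case (Some a)
      have a: "a \<in> {1..S}" using nth_states[OF y i] Some by simp
      show ?thesis
        unfolding Some K_Some[OF None a] using P01[OF x, of i] \<Lambda>[OF x, of i] shat_pos[OF x a, of i] by simp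
    qed
  next
    case (Some a)
    then have "y ! i = Some a" using joint_law_posD(2)[of q0, OF q0 u h pos i] by simp
    then show ?thesis using Some by (simp add: coord_trans_def)
  qed
  then show "(\<Prod>i<d. ?K x i (y ! i)) > 0"
    if "x \<in> states d S" "y \<in> states d S" "?\<pi> y x > 0" for x y
    using that by (intro prod_pos) auto
  \<comment> \<open>Coordinatewise log ratio with the bare unmasking probability
    \<open>\<rho>\<close> in place of the probability of a given symbol. The conditional
    probabilities of the symbols combine to the ratio of \<open>revealed_marginal\<close> at y and
    x, which need not factor over coordinates and is treated as the drift.\<close>
  define \<theta> where "\<theta> x i c = (if x ! i = None then ln ((if c = None then 1 - \<rho> else \<rho>) / ?K x i c) else 0)"
    for x :: state and i and c :: "nat option"
  have split: "?\<pi> y x * ln (?\<pi> y x / (?q s x * (\<Prod>i<d. ?K x i (y ! i)))) =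
      ?\<pi> y x * (?f y - ?f x) + (\<Sum>i<d. \<theta> x i (y ! i) * ?\<pi> y x)"
    if x: "x \<in> states d S" and y: "y \<in> states d S" for x y
  proof (cases "?\<pi> y x > 0")
    case False
    then have "?\<pi> y x = 0" using joint_law_nonneg[of q0, OF q0 u h, of d S y x] by simp
    then show ?thesis by simp
  next
    case True
    note D = joint_law_posD[of q0, OF q0 u h True]
    have my: "?m y > 0" using revealed_marginal_pos[OF q0 D(1)] .
    have "?q s x > 0"
      using sum_pos2[of "states d S" y "\<lambda>y. ?\<pi> y x"] y True joint_law_nonneg[of q0, OF q0 u h]
      by (simp add: s_def sum_joint_law_right[OF x])
    then have mx: "?m x > 0" using revealed_marginal_pos[of q0, OF q0] by blast
    \<comment> \<open>Where x is masked this is the ratio inside \<open>\<theta>\<close>; where x is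
      unmasked the factors give exp (-u) exp (-h) / exp (-s) = 1.\<close>
    define F where "F i = coord_weight u (y ! i) * remask h (y ! i) (x ! i) / (coord_weight s (x ! i) * ?K x i (y ! i))" for i
    have F: "F i > 0 \<and> ln (F i) = \<theta> x i (y ! i)" if i: "i < d" for i
    proof (cases "x ! i")
      case None
      have K: "?K x i (y ! i) > 0" using Kpos[OF x y True i] .
      have "F i = (if y ! i = None then 1 - \<rho> else \<rho>) / ?K x i (y ! i)"
        unfolding F_def None
        by (cases "y ! i = None") (auto simp: coord_weight_def remask_def coord_law_def \<rho>1, simp add: \<rho>2)
      moreover have "(if y ! i = None then 1 - \<rho> else \<rho>) > 0"
        using D(3)[OF i] \<rho>u(1) \<rho>0 by auto
      ultimately show ?thesis using K None by (simp add: \<theta>_def)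
    next
      case (Some a)
      then have ya: "y ! i = Some a" using D(2)[OF i] by simp
      have "F i = 1"
        unfolding F_def Some ya using Some
        by (simp add: coord_weight_def remask_def coord_law_def coord_trans_def s_def exp_add[symmetric])
      then show ?thesis using Some by (simp add: \<theta>_def)
    qed
    have "?\<pi> y x / (?q s x * (\<Prod>i<d. ?K x i (y ! i))) = ?m y / ?m x * (\<Prod>i<d. F i)"
      unfolding F_def joint_law_def mask_law_factor prod_dividef prod.distrib by (simp add: mult_ac)
    also have "ln \<dots> = ln (?m y) - ln (?m x) + ln (\<Prod>i<d. F i)"
      using mx my prod_pos[of "{..<d}" F] F by (simp add: ln_mult ln_div less_imp_neq[symmetric])
    also have "ln (\<Prod>i<d. F i) = (\<Sum>i<d. ln (F i))"
      by (rule ln_prod) (simp, metis F lessThan_iff less_irrefl)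
    also have "\<dots> = (\<Sum>i<d. \<theta> x i (y ! i))"
      using F by (intro sum.cong) auto
    finally have "ln (?\<pi> y x / (?q s x * (\<Prod>i<d. ?K x i (y ! i)))) = ?f y - ?f x + (\<Sum>i<d. \<theta> x i (y ! i))"
      by (simp only: log_marginal_def)
    then show ?thesis by (simp only: distrib_left sum_distrib_left mult.commute)
  qed
  have drift: "(\<Sum>y\<in>states d S. \<Sum>x\<in>states d S. ?\<pi> y x * (?f y - ?f x)) =
      mask_expect d S q0 ?f u - mask_expect d S q0 ?f s"
  proof -
    have "(\<Sum>y\<in>states d S. \<Sum>x\<in>states d S. ?\<pi> y x * ?f y) = mask_expect d S q0 ?f u"
      unfolding mask_expect_def by (intro sum.cong refl) (simp add: sum_joint_law_left flip: sum_distrib_right)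
    moreover have "(\<Sum>y\<in>states d S. \<Sum>x\<in>states d S. ?\<pi> y x * ?f x) = mask_expect d S q0 ?f s"
      unfolding mask_expect_def
      by (subst sum.swap) (intro sum.cong refl, simp add: sum_joint_law_right s_def flip: sum_distrib_right)
    ultimately show ?thesis by (simp add: right_diff_distrib sum_subtractf)
  qed
  \<comment> \<open>The first term on the right is a part of the score entropy; the subtracted one
    is, up to sign, a part of the expected generator in the form of
    \<open>mask_expect_generator\<close>.\<close>
  have coord: "(\<Sum>y\<in>states d S. \<theta> x i (y ! i) * ?\<pi> y x) \<le>
      ?e * (?q s x * (\<Sum>a\<in>{1..S}. weighted_D (shat k (x[i := Some a]) x) (score d S q0 s (x[i := Some a]) x)))
      - ?e * (\<Sum>a\<in>{1..S}. ?q s (x[i := Some a]) * (?f (x[i := Some a]) - ?f x))"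
    if i: "i < d" and x: "x \<in> states d S" "x ! i = None" for x i
  proof -
    define sc where "sc a = score d S q0 s (x[i := Some a]) x" for a
    have q_nn: "?q s y \<ge> 0" for y using mask_law_nonneg[of q0 s d S y] q0 s by simp
    have total: "(\<Sum>a\<in>{1..S}. ?q s (x[i := Some a])) = \<mu> * ?q s x"
    proof -
      have "(\<Sum>a\<in>{1..S}. ?q s (x[i := Some a])) = exp (- s) * (\<Sum>z\<in>data_states d S. q0 z * rest_law d s i z x)"
        using sum_mask_law_Some[OF i x(1), of "\<lambda>_. 1" q0 s] by simp
      moreover have "exp (- s) = \<mu> * (1 - exp (- s))"
        using s by (simp add: \<mu>_def exp_minus field_simps)
      ultimately show ?thesis
        using mask_law_masked[OF i length_states[OF x(1)] x(2), of S q0 s] by simp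
    qed
    have lhs: "(\<Sum>y\<in>states d S. \<theta> x i (y ! i) * ?\<pi> y x) =
      (1 - \<rho>) * ln ((1 - \<rho>) / ?P x i) * ?q s x +
      ?e * (\<Sum>a\<in>{1..S}. ?q s (x[i := Some a]) * ln (\<rho> / ((1 - ?P x i) * shat k (x[i := Some a]) x / ?\<Lambda> x i)))"
    proof -
      have "(\<Sum>a\<in>{1..S}. \<theta> x i (Some a) * ?q s (x[i := Some a])) =
        (\<Sum>a\<in>{1..S}. ?q s (x[i := Some a]) * ln (\<rho> / ((1 - ?P x i) * shat k (x[i := Some a]) x / ?\<Lambda> x i)))"
        using x(2) by (intro sum.cong refl) (simp add: \<theta>_def K_Some)
      moreover have "\<theta> x i None = ln ((1 - \<rho>) / ?P x i)" using x(2) by (simp add: \<theta>_def K_None)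
      ultimately show ?thesis
        using sum_masked_joint_law[OF i x, of u h "\<theta> x i" q0] s by (simp add: s_def[symmetric] \<rho>1[symmetric])
    qed
    show ?thesis
    \<comment> \<open>Scores at x are quotients by the mass of x, so zero mass is treated apart; by
      \<open>total\<close> the revealed neighbours then have zero mass too.\<close>
    proof (cases "?q s x > 0")
      case False
      then have q0x: "?q s x = 0" using q_nn[of x] by simp
      then have "\<forall>a\<in>{1..S}. ?q s (x[i := Some a]) = 0"
        using total q_nn by (simp add: sum_nonneg_eq_0_iff)
      then show ?thesis unfolding lhs q0x by simp
    next
      case True
      have q_sc: "?q s (x[i := Some a]) = ?q s x * sc a" for a
        using True by (simp add: sc_def score_def)
      have "?q s x * sum sc {1..S} = ?q s x * \<mu>"
        using total by (simp add: q_sc sum_distrib_left mult.commute)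
      then have sum_sc: "sum sc {1..S} = \<mu>" using True by simp
      \<comment> \<open>The score is \<open>\<mu>\<close> times a ratio of revealed marginals, so
        the subtracted term of \<open>coordinate_error_le\<close> becomes an increment of the log
        marginal.\<close>
      have log_ratio: "sc a * ln (sc a / \<mu>) = sc a * (?f (x[i := Some a]) - ?f x)" if "a \<in> {1..S}" for a
      proof (cases "sc a = 0")
        case False
        then have sc_pos: "sc a > 0" using q_nn by (simp add: sc_def score_def less_le)
        then have qa: "?q s (x[i := Some a]) > 0" using True q_sc by simp
        have ma: "?m (x[i := Some a]) > 0" using revealed_marginal_pos[OF q0 qa] .
        have mx: "?m x > 0" using revealed_marginal_pos[OF q0 True] .
        let ?R = "rest_weight d s {i} x"
        have qx: "?q s x = (1 - exp (- s)) * ?R * ?m x"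
          using rest_weight_remove[OF i, of "{}" s x] x by (simp add: mask_law_rest_weight coord_weight_def)
        have qxa: "?q s (x[i := Some a]) = exp (- s) * ?R * ?m (x[i := Some a])"
          using rest_weight_remove[OF i, of "{}" s "x[i := Some a]"] i x by (simp add: mask_law_rest_weight coord_weight_def)
        have "?R \<noteq> 0" using True unfolding qx by auto
        then have "sc a = exp (- s) / (1 - exp (- s)) * (?m (x[i := Some a]) / ?m x)"
          unfolding sc_def score_def qx qxa by simp
        also have "exp (- s) / (1 - exp (- s)) = \<mu>"
          using s by (simp add: \<mu>_def exp_minus field_simps)
        finally have "sc a / \<mu> = ?m (x[i := Some a]) / ?m x" using \<mu> by simp
        then show ?thesis using ma mx by (simp add: log_marginal_def ln_div)
      qed simp
      have "(1 - \<rho>) * ln ((1 - \<rho>) / ?P x i) +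
          ?e * (\<Sum>a\<in>{1..S}. sc a * ln (\<rho> / ((1 - ?P x i) * shat k (x[i := Some a]) x / ?\<Lambda> x i)))
        \<le> ?e * (\<Sum>a\<in>{1..S}. weighted_D (shat k (x[i := Some a]) x) (sc a)) - ?e * (\<Sum>a\<in>{1..S}. sc a * ln (sc a / \<mu>))"
        unfolding \<rho>_def Lam_def
      proof (rule coordinate_error_le)
        show "0 < ?e * \<mu> \<and> ?e * \<mu> < 1 \<and>
           ?P x i = exp ((\<Sum>a\<in>{1..S}. shat k (x[i := Some a]) x) / \<mu> * ln (1 - ?e * \<mu>)) \<or> ?e * \<mu> = 1 \<and> ?P x i = 0"
          using P[of x i] by (simp only: \<rho>_def Lam_def)
        show "sc a \<ge> 0" for a using q_nn by (simp add: sc_def score_def)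
      qed (use S sum_sc \<mu> e shat_pos[OF x(1)] in auto)
      also have "(\<Sum>a\<in>{1..S}. sc a * ln (sc a / \<mu>)) = (\<Sum>a\<in>{1..S}. sc a * (?f (x[i := Some a]) - ?f x))"
        using log_ratio by (rule sum.cong[OF refl])
      finally have "?q s x * ((1 - \<rho>) * ln ((1 - \<rho>) / ?P x i) +
          ?e * (\<Sum>a\<in>{1..S}. sc a * ln (\<rho> / ((1 - ?P x i) * shat k (x[i := Some a]) x / ?\<Lambda> x i))))
        \<le> ?q s x * (?e * (\<Sum>a\<in>{1..S}. weighted_D (shat k (x[i := Some a]) x) (sc a)) -
           ?e * (\<Sum>a\<in>{1..S}. sc a * (?f (x[i := Some a]) - ?f x)))"
        using True by (intro mult_left_mono) auto
      then show ?thesis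
        unfolding lhs q_sc sc_def[symmetric]
        by (simp add: distrib_left right_diff_distrib sum_distrib_left mult_ac)
    qed
  qed
  define A where "A i x = ?q s x *
    (\<Sum>a\<in>{1..S}. weighted_D (shat k (x[i := Some a]) x) (score d S q0 s (x[i := Some a]) x))" for i x
  define B where "B i x = (\<Sum>a\<in>{1..S}. ?q s (x[i := Some a]) * (?f (x[i := Some a]) - ?f x))" for i x
  have A: "L_SE d S q0 s (shat k) = (\<Sum>i<d. \<Sum>x\<in>{x\<in>states d S. x ! i = None}. A i x)"
    unfolding A_def using s by (intro L_SE_eq q0) simp
  have B: "mask_expect d S q0 (mask_generator d ?f) s = - (\<Sum>i<d. \<Sum>x\<in>{x\<in>states d S. x ! i = None}. B i x)"
    unfolding B_def by (rule mask_expect_generator)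
  have "(\<Sum>y\<in>states d S. \<Sum>x\<in>states d S. ?\<pi> y x * ln (?\<pi> y x / (?q s x * (\<Prod>i<d. ?K x i (y ! i))))) =
     (\<Sum>y\<in>states d S. \<Sum>x\<in>states d S. ?\<pi> y x * (?f y - ?f x) + (\<Sum>i<d. \<theta> x i (y ! i) * ?\<pi> y x))"
    by (intro sum.cong refl split)
  also have "\<dots> = (mask_expect d S q0 ?f u - mask_expect d S q0 ?f s) +
     (\<Sum>y\<in>states d S. \<Sum>x\<in>states d S. \<Sum>i<d. \<theta> x i (y ! i) * ?\<pi> y x)"
    by (simp only: sum.distrib drift)
  also have "(\<Sum>y\<in>states d S. \<Sum>x\<in>states d S. \<Sum>i<d. \<theta> x i (y ! i) * ?\<pi> y x) =
     (\<Sum>x\<in>states d S. \<Sum>y\<in>states d S. \<Sum>i<d. \<theta> x i (y ! i) * ?\<pi> y x)"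
    by (rule sum.swap)
  also have "\<dots> = (\<Sum>x\<in>states d S. \<Sum>i<d. \<Sum>y\<in>states d S. \<theta> x i (y ! i) * ?\<pi> y x)"
    by (intro sum.cong refl sum.swap)
  also have "\<dots> = (\<Sum>i<d. \<Sum>x\<in>states d S. \<Sum>y\<in>states d S. \<theta> x i (y ! i) * ?\<pi> y x)"
    by (rule sum.swap)
  also have "\<dots> = (\<Sum>i<d. \<Sum>x\<in>{x\<in>states d S. x ! i = None}. \<Sum>y\<in>states d S. \<theta> x i (y ! i) * ?\<pi> y x)"
    unfolding sum_masked_filter by (intro sum.cong refl) (auto simp: \<theta>_def)
  also have "\<dots> \<le> (\<Sum>i<d. \<Sum>x\<in>{x\<in>states d S. x ! i = None}. ?e * A i x - ?e * B i x)"
  proof (rule sum_mono, rule sum_mono)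
    fix i x assume "i \<in> {..<d}" "x \<in> {x\<in>states d S. x ! i = None}"
    then show "(\<Sum>y\<in>states d S. \<theta> x i (y ! i) * ?\<pi> y x) \<le> ?e * A i x - ?e * B i x"
      unfolding A_def B_def by (intro coord) auto
  qed
  also have "\<dots> = ?e * L_SE d S q0 s (shat k) + ?e * mask_expect d S q0 (mask_generator d ?f) s"
    unfolding A B by (simp only: sum_subtractf sum_distrib_left mult_minus_right diff_conv_add_uminus sum.distrib sum_negf)
  \<comment> \<open>The drift and the generator term are kept together: their sum is the left side
    of \<open>linearization_gap_le\<close>.\<close>
  also have "mask_expect d S q0 ?f u - mask_expect d S q0 ?f s + \<dots> =
     ?e * L_SE d S q0 s (shat k) + (mask_expect d S q0 ?f u - mask_expect d S q0 ?f s + ?e * mask_expect d S q0 (mask_generator d ?f) s)"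
    by simp
  also have "\<dots> \<le> ?e * L_SE d S q0 s (shat k) + ?e * integral {u..u + h} (eff_tc d S q0)"
    using linearization_gap_le[of q0 u h d S, OF q0 u] h by (simp add: s_def)
  finally show "(\<Sum>y\<in>states d S. \<Sum>x\<in>states d S. ?\<pi> y x *
        ln (?\<pi> y x / (?q (u + h) x * (\<Prod>i<d. ?K x i (y ! i)))))
      \<le> ?e * (L_SE d S q0 (u + h) (shat k) + integral {u..u + h} (eff_tc d S q0))"
    by (simp add: s_def distrib_left)
qed

section \<open>Summation over the grid\<close>

lemma exp_minus_one_le:
  fixes h c :: real
  assumes "0 \<le> h" "h \<le> c" "0 < c"
  shows "exp h - 1 \<le> (exp c - 1) / c * h"
proof -
  have "convex_on UNIV (exp :: real \<Rightarrow> real)" by (rule exp_convex)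
  then have "exp ((1 - h / c) *\<^sub>R 0 + (h / c) *\<^sub>R c) \<le> (1 - h / c) * exp 0 + (h / c) * exp c"
    using assms by (intro convex_onD) auto
  then have "exp h \<le> (1 - h / c) + h / c * exp c" using assms by simp
  then show ?thesis by (simp add: diff_divide_distrib algebra_simps)
qed

theorem theorem3:
  fixes c0 :: real
  assumes c0_pos: "c0 > 0"
  shows "\<exists>C > 0. \<forall>(d::nat) (S::nat) (q0::state \<Rightarrow> real) (T::real) (N::nat) (t::nat \<Rightarrow> real)
            (shat::nat \<Rightarrow> state \<Rightarrow> state \<Rightarrow> real) (eps::real).
     d \<ge> 1 \<longrightarrow> S \<ge> 2 \<longrightarrow>
     (\<forall>x. q0 x \<ge> 0) \<longrightarrow> (\<forall>x. x \<notin> data_states d S \<longrightarrow> q0 x = 0) \<longrightarrow>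
     (\<Sum>x\<in>data_states d S. q0 x) = 1 \<longrightarrow>
     T > 0 \<longrightarrow> t 0 = 0 \<longrightarrow> t N = T \<longrightarrow> (\<forall>k<N. t k < t (Suc k)) \<longrightarrow>
     (\<forall>k<N. t (Suc k) - t k \<le> c0) \<longrightarrow>
     (\<forall>k<N. \<forall>x\<in>states d S. \<forall>y\<in>states d S. shat k y x > 0) \<longrightarrow>
     (\<Sum>k<N. (t (Suc k) - t k) * L_SE d S q0 (T - t k) (shat k)) \<le> eps \<longrightarrow>
     KL (states d S) q0 (alg_law d S T t N shat N)
       \<le> ereal (C * (eps + exp (- T) * real d * ln (real S)
              + (\<Sum>k<N. (t (Suc k) - t k) *
                   integral {T - t (Suc k) .. T - t k} (eff_tc d S q0))))"
proof (intro exI[of _ "(exp c0 - 1) / c0"] conjI allI impI)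
  let ?C = "(exp c0 - 1) / c0"
  show "?C > 0" using c0_pos by simp
  fix d S N :: nat and q0 :: "state \<Rightarrow> real" and T eps :: real and t :: "nat \<Rightarrow> real"
    and shat :: "nat \<Rightarrow> state \<Rightarrow> state \<Rightarrow> real"
  assume S: "S \<ge> 2" and q0_all: "\<forall>x. q0 x \<ge> 0" and supp: "\<forall>x. x \<notin> data_states d S \<longrightarrow> q0 x = 0"
    and sum1: "(\<Sum>x\<in>data_states d S. q0 x) = 1" and T: "T > 0" and t0: "t 0 = 0" and tN: "t N = T"
    and step: "\<forall>k<N. t k < t (Suc k)" and small: "\<forall>k<N. t (Suc k) - t k \<le> c0"
    and shat_all: "\<forall>k<N. \<forall>x\<in>states d S. \<forall>y\<in>states d S. shat k y x > 0"
    and eps: "(\<Sum>k<N. (t (Suc k) - t k) * L_SE d S q0 (T - t k) (shat k)) \<le> eps"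
  have q0: "q0 x \<ge> 0" for x using q0_all by simp
  have "c0 \<le> exp c0 - 1" using exp_ge_add_one_self[of c0] by linarith
  then have C1: "?C \<ge> 1" using c0_pos by (simp add: le_divide_eq)
  have mono: "j \<le> k \<Longrightarrow> k \<le> N \<Longrightarrow> t j \<le> t k" for j k
  proof (induction k rule: dec_induct)
    case (step k)
    then show ?case using \<open>\<forall>k<N. t k < t (Suc k)\<close>[rule_format, of k] by simp
  qed simp
  have lt: "t k < T" if "k < N" for k
    using mono[of "Suc k" N] step that tN by (auto intro: less_le_trans)
  define L where "L k = L_SE d S q0 (T - t k) (shat k)" for k
  define I where "I k = integral {T - t (Suc k)..T - t k} (eff_tc d S q0)" for k
  define h where "h k = t (Suc k) - t k" for k
  define p where "p = alg_law d S T t N shat"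
  let ?q = "mask_law d S q0"
  have one_step: "(\<forall>y\<in>states d S. p (Suc k) y \<ge> 0) \<and>
      (\<forall>y\<in>states d S. ?q (T - t (Suc k)) y > 0 \<longrightarrow> p (Suc k) y > 0) \<and>
      (\<Sum>y\<in>states d S. ?q (T - t (Suc k)) y * ln (?q (T - t (Suc k)) y / p (Suc k) y)) \<le>
        (\<Sum>x\<in>states d S. ?q (T - t k) x * ln (?q (T - t k) x / p k x)) + (exp (h k) - 1) * (L k + I k)"
    if k: "k < N" and nn: "\<And>x. x \<in> states d S \<Longrightarrow> p k x \<ge> 0"
      and pos: "\<And>x. x \<in> states d S \<Longrightarrow> ?q (T - t k) x > 0 \<Longrightarrow> p k x > 0" for k
  proof -
    define u where "u = T - t (Suc k)"
    have hk: "h k > 0" using step k by (simp add: h_def)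
    have uh: "u + h k = T - t k" by (simp add: u_def h_def)
    have u0: "u \<ge> 0" using mono[of "Suc k" N] k tN by (simp add: u_def)
    \<comment> \<open>The step that reaches time 0 is exactly the last one, so the forced unmasking
      of the algorithm matches the case u = 0.\<close>
    have u_iff: "u > 0 \<longleftrightarrow> k < N - 1"
    proof
      assume "k < N - 1"
      then show "u > 0" using lt[of "Suc k"] by (simp add: u_def)
    next
      assume "u > 0"
      then have "Suc k \<noteq> N" using tN by (auto simp: u_def)
      then show "k < N - 1" using k by simp
    qed
    have shat: "shat k y x > 0" if "x \<in> states d S" "y \<in> states d S" for x y
      using shat_all k that by blast
    have stay: "stay_prob S T t N shat k x i =
      (if u > 0 then exp (Lam S shat k x i * (exp (u + h k) - 1) * ln (1 - (exp (h k) - 1) / (exp (u + h k) - 1))) else 0)"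
      for x i
    proof (cases "u > 0")
      case True
      have "1 - (exp (h k) - 1) / (exp (u + h k) - 1) = (exp (u + h k) - exp (h k)) / (exp (u + h k) - 1)"
        using True hk by (simp add: field_simps)
      \<comment> \<open>Multiplying by exp (t k) turns remaining times into grid times and produces
        the quotient in \<open>Delta\<close>.\<close>
      also have "\<dots> = (exp (t k) * (exp (u + h k) - exp (h k))) / (exp (t k) * (exp (u + h k) - 1))"
        by simp
      also have "exp (t k) * (exp (u + h k) - exp (h k)) = exp T - exp (t (Suc k))"
        by (simp add: right_diff_distrib exp_add[symmetric] u_def h_def)
      also have "exp (t k) * (exp (u + h k) - 1) = exp T - exp (t k)"
        by (simp add: right_diff_distrib exp_add[symmetric] u_def h_def)
      finally have "ln (1 - (exp (h k) - 1) / (exp (u + h k) - 1)) =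
          - ln ((exp T - exp (t k)) / (exp T - exp (t (Suc k))))"
        using True lt[OF k] by (simp add: ln_div u_def)
      then show ?thesis using True u_iff by (simp add: stay_prob_def Delta_def uh)
    next
      case False
      then show ?thesis using u_iff by (simp add: stay_prob_def)
    qed
    let ?K = "\<lambda>x y. \<Prod>i<d. coord_trans S T t N shat k x i (y ! i)"
    note err = tau_leaping_step_error[where d = d and S = S and u = u and h = "h k" and shat = shat
        and k = k and T = T and t = t and N = N and ?q0.0 = q0, OF q0 _ u0 hk shat stay]
    have S1: "S \<ge> 1" using S by simp
    have p_Suc: "p (Suc k) y = (\<Sum>x\<in>states d S. p k x * ?K x y)" for y
      by (simp add: p_def)
    have joint_nn: "joint_law d S q0 u (h k) y x \<ge> 0" for x y
      by (rule joint_law_nonneg[of q0, OF q0 u0 hk])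
    note chain = KL_chain_step[where X = "states d S" and \<pi> = "joint_law d S q0 u (h k)" and q' = "?q u"
        and q = "?q (T - t k)" and p = "p k" and K = ?K and p' = "p (Suc k)"]
    have nn': "p (Suc k) y \<ge> 0" if "y \<in> states d S" for y
      unfolding p_Suc using that nn err(1)[OF S1] by (intro sum_nonneg mult_nonneg_nonneg) auto
    have pos': "p (Suc k) y > 0" if "y \<in> states d S" "?q u y > 0" for y
      by (rule chain(1)) (use that joint_nn nn pos err(1,2)[OF S1] p_Suc in
        \<open>auto simp: sum_joint_law_left sum_joint_law_right uh\<close>)
    have "(\<Sum>y\<in>states d S. ?q u y * ln (?q u y / p (Suc k) y)) \<le>
       (\<Sum>x\<in>states d S. ?q (T - t k) x * ln (?q (T - t k) x / p k x)) +
       (\<Sum>y\<in>states d S. \<Sum>x\<in>states d S. joint_law d S q0 u (h k) y x *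
         ln (joint_law d S q0 u (h k) y x / (?q (T - t k) x * ?K x y)))"
      by (rule chain(2)) (use joint_nn nn pos err(1,2)[OF S1] p_Suc in
        \<open>auto simp: sum_joint_law_left sum_joint_law_right uh\<close>)
    also have "\<dots> \<le> (\<Sum>x\<in>states d S. ?q (T - t k) x * ln (?q (T - t k) x / p k x)) +
       (exp (h k) - 1) * (L k + I k)"
      using err(3)[OF S1] unfolding uh by (simp add: L_def I_def u_def)
    finally show ?thesis using nn' pos' by (simp add: u_def)
  qed
  \<comment> \<open>Positivity on the support of the true law is part of the invariant, because each
    application of \<open>KL_chain_step\<close> requires it.\<close>
  have invariant: "(\<forall>y\<in>states d S. p k y \<ge> 0) \<and> (\<forall>y\<in>states d S. ?q (T - t k) y > 0 \<longrightarrow> p k y > 0) \<and>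
      (\<Sum>y\<in>states d S. ?q (T - t k) y * ln (?q (T - t k) y / p k y)) \<le>
        exp (- T) * real d * ln (real S) + (\<Sum>j<k. (exp (h j) - 1) * (L j + I j))"
    if "k \<le> N" for k
    using that
  proof (induction k)
    case 0
    have "init_law d S T x > 0" if x: "x \<in> states d S" for x
      unfolding init_law_def
    proof (intro prod_pos ballI)
      fix i assume "i \<in> {..<d}"
      then have "x ! i \<in> vocab S" using x by simp
      then show "0 < (if x ! i = None then 1 - exp (- T) else if x ! i \<in> Some ` {1..S} then exp (- T) / real S else 0)"
        using T S by (auto simp: vocab_def)
    qed
    then show ?case
      using KL_init_law_le[OF q0 sum1 _ T] S t0 by (simp add: p_def less_imp_le)
  next
    case (Suc k)
    then have "k < N" "k \<le> N" by auto
    with Suc.IH one_step[of k] show ?case by force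
  qed
  \<comment> \<open>At time 0 the coordinate laws are point masses, so the process starts in the
    data law.\<close>
  have q_data: "?q 0 x = q0 x" if x: "x \<in> states d S" for x
  proof -
    have prod: "(\<Prod>i<d. coord_law 0 (z ! i) (x ! i)) = (if z = x then 1 else 0)" if z: "z \<in> data_states d S" for z
    proof (cases "z = x")
      case True
      have "coord_law 0 (z ! i) (x ! i) = 1" if "i < d" for i
        using nth_data_states[OF z that] True by (auto simp: coord_law_def)
      then show ?thesis using True by (simp add: prod.neutral)
    next
      case False
      then obtain i where i: "i < d" "z ! i \<noteq> x ! i"
        using x z data_states_subset[of d S] by (metis length_states nth_equalityI subsetD)
      have "coord_law 0 (z ! i) (x ! i) = 0" using i by (auto simp: coord_law_def)
      then show ?thesis using False i(1) by (auto intro!: prod_zero)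
    qed
    have "?q 0 x = (\<Sum>z\<in>data_states d S. if z = x then q0 z else 0)"
      unfolding mask_law_eq by (intro sum.cong refl) (simp add: prod)
    also have "\<dots> = (if x \<in> data_states d S then q0 x else 0)" by (simp add: sum.delta)
    finally show ?thesis using supp by auto
  qed
  have pN: "p N y > 0" if "y \<in> states d S" "q0 y > 0" for y
    using invariant[of N] that q_data tN by auto
  have bound: "(\<Sum>y\<in>states d S. q0 y * ln (q0 y / p N y)) \<le>
      exp (- T) * real d * ln (real S) + (\<Sum>j<N. (exp (h j) - 1) * (L j + I j))"
    using invariant[of N] q_data tN by simp
  have "(\<Sum>j<N. (exp (h j) - 1) * (L j + I j)) \<le> (\<Sum>j<N. ?C * (h j * L j + h j * I j))"
  proof (rule sum_mono)
    fix j assume "j \<in> {..<N}"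
    then have j: "j < N" by simp
    have "L j \<ge> 0"
      unfolding L_def using lt[OF j] shat_all j by (intro L_SE_nonneg q0) auto
    moreover have "I j \<ge> 0"
    proof -
      have "T - t (Suc j) \<ge> 0" using mono[of "Suc j" N] j tN by simp
      \<comment> \<open>Both cases give a nonnegative value: by convention a function that is not
        integrable has integral 0.\<close>
      then show ?thesis
        unfolding I_def using eff_tc_nonneg[of q0 _ d S] q0
        by (cases "eff_tc d S q0 integrable_on {T - t (Suc j)..T - t j}")
           (auto intro!: integral_nonneg simp: not_integrable_integral)
    qed
    moreover have "exp (h j) - 1 \<le> ?C * h j"
      using step small j c0_pos by (intro exp_minus_one_le) (auto simp: h_def less_imp_le)
    ultimately have "(exp (h j) - 1) * (L j + I j) \<le> ?C * h j * (L j + I j)"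
      by (intro mult_right_mono) auto
    then show "(exp (h j) - 1) * (L j + I j) \<le> ?C * (h j * L j + h j * I j)"
      by (simp add: distrib_left mult.assoc)
  qed
  also have "\<dots> = ?C * ((\<Sum>j<N. h j * L j) + (\<Sum>j<N. h j * I j))"
    by (simp only: sum.distrib sum_distrib_left[symmetric])
  also have "\<dots> \<le> ?C * (eps + (\<Sum>j<N. h j * I j))"
    using eps C1 by (intro mult_left_mono) (auto simp: L_def h_def)
  finally have sum_le: "(\<Sum>j<N. (exp (h j) - 1) * (L j + I j)) \<le> ?C * (eps + (\<Sum>j<N. h j * I j))" .
  have "exp (- T) * real d * ln (real S) \<ge> 0" using S by simp
  then have "exp (- T) * real d * ln (real S) \<le> ?C * (exp (- T) * real d * ln (real S))"
    using mult_right_mono[OF C1] by fastforce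
  then have total: "(\<Sum>y\<in>states d S. q0 y * ln (q0 y / p N y)) \<le>
      ?C * (eps + exp (- T) * real d * ln (real S) + (\<Sum>j<N. h j * I j))"
    using bound sum_le by (simp only: distrib_left)
  \<comment> \<open>Positivity of the output law on the support of \<open>q0\<close> selects the
    finite branch of \<open>KL\<close>.\<close>
  have "KL (states d S) q0 (p N) = ereal (\<Sum>y\<in>{y\<in>states d S. q0 y > 0}. q0 y * ln (q0 y / p N y))"
    unfolding KL_def using pN by force
  also have "(\<Sum>y\<in>{y\<in>states d S. q0 y > 0}. q0 y * ln (q0 y / p N y)) =
      (\<Sum>y\<in>states d S. q0 y * ln (q0 y / p N y))"
    using q0 by (intro sum.mono_neutral_left) (auto simp: not_less antisym)
  finally show "KL (states d S) q0 (alg_law d S T t N shat N)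
       \<le> ereal (?C * (eps + exp (- T) * real d * ln (real S)
              + (\<Sum>k<N. (t (Suc k) - t k) *
                   integral {T - t (Suc k) .. T - t k} (eff_tc d S q0))))"
    using total by (simp add: p_def h_def I_def)
qed

end
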